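(* Let $V\subseteq B_d$ be a variety that contains at least two points, and let $(W_n)_{n\in\mathbb{N}}$ be a sequence of varieties in $B_d$. Assume that for every $n\in\mathbb{N}$ there exists a multiplier algebra isomorphism $\varphi_n:\mathcal{M}_V\to\mathcal{M}_{W_n}$, given by $\varphi_n(f)=f\circ G_{\varphi_n}$ for $f\in\mathcal{M}_V$ (so that $G_{\varphi_n}:W_n\to V$ is a bijection). Assume that $\|\varphi_n^{(d)}\|\to 1$ and $\|(\varphi_n^{-1})^{(d)}\|\to 1$ as $n\to\infty$. Then $\|G_{\varphi_n}\|_{\mathrm{Mult}(W_n)}\to 1$ and $\|G_{\varphi_n}^{-1}\|_{\mathrm{Mult}(V)}\to 1$ as $n\to\infty$.
   Context: $d$ is a positive integer, $\mathbb{C}^d$ carries the standard inner product $\langle\cdot,\cdot\rangle$, and $B_d$ is its open unit ball. $\mathcal{H}_d^2$ is the Drury–Arveson space: the reproducing kernel Hilbert space (RKHS) on $B_d$ with kernel $k(x,y)=\frac{1}{1-\langle x,y\rangle}$; $k_x=k(\cdot,x)$. A variety in $B_d$ is a set of the form $V=\{x\in B_d: f(x)=0\ \forall f\in F\}$ for some nonempty $F\subseteq\mathcal{H}_d^2$. $H_V=\overline{\mathrm{span}}\{k_x:x\in V\}\subseteq\mathcal{H}_d^2$, identified (by restriction to $V$) with the RKHS on $V$ with kernel $k|_{V\times V}$. $\mathcal{M}_V=\mathrm{Mult}(H_V)$ is the algebra of functions $f:V\to\mathbb{C}$ with $fH_V\subseteq H_V$, identified with the algebra of multiplication operators $M_f$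 on $H_V$; a matrix in $M_n(\mathcal{M}_V)$ is normed as an operator on $\oplus_{i=1}^n H_V$. For a linear map $\varphi:\mathcal{M}_V\to\mathcal{M}_W$, $\varphi^{(n)}:M_n(\mathcal{M}_V)\to M_n(\mathcal{M}_W)$ is entrywise application of $\varphi$, and $\|\varphi\|_{cb}=\sup_n\|\varphi^{(n)}\|$. A vector valued multiplier on $V$ is a tuple $F=(f_1,\dots,f_d)$ with $f_i\in\mathcal{M}_V$; $\|F\|_{\mathrm{Mult}(V)}$ is the norm of the row operator $(M_{f_1},\dots,M_{f_d}):\oplus_{i=1}^d H_V\to H_V$. A multiplier algebra isomorphism $\varphi:\mathcal{M}_V\to\mathcal{M}_W$ is a completely bounded algebra isomorphism with completely bounded inverse of the form $\varphi(f)=f\circ G$ for a bijection $G:W\to V$. With $Z_i$ the coordinate functions, $G_\varphi:=(\varphi(Z_1|_V),\dots,\varphi(Z_d|_V))$; then necessarily $G=G_\varphi$ and $G^{-1}=G_{\varphi^{-1}}=(\varphi^{-1}(Z_1|_W),\dots,\varphi^{-1}(Z_d|_W))$, so both are vector valued multipliers. *)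

theory Defs
  imports "HOL-Analysis.Analysis" "HOL-Library.Function_Algebras"
begin

text \<open>
  A function on a set \<open>X\<close> is encoded as a total function vanishing outside \<open>X\<close>, so that
  equality is equality on \<open>X\<close> and the pointwise algebra operations of
  \<^theory>\<open>HOL-Library.Function_Algebras\<close> apply (the constant function \<open>1\<close> on \<open>X\<close> is
  \<open>restr X 1\<close>).
\<close>

definition restr :: "'a set \<Rightarrow> ('a \<Rightarrow> complex) \<Rightarrow> 'a \<Rightarrow> complex" where
  "restr X f = (\<lambda>x. if x \<in> X then f x else 0)"

definition cscale :: "complex \<Rightarrow> ('a \<Rightarrow> complex) \<Rightarrow> 'a \<Rightarrow> complex" where
  "cscale c f = (\<lambda>x. c * f x)"

global_interpretation cfun: vector_space cscale
  by unfold_locales (auto simp: cscale_def fun_eq_iff algebra_simps)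

record 'a fun_space =
  fcarrier :: "('a \<Rightarrow> complex) set"
  finner :: "('a \<Rightarrow> complex) \<Rightarrow> ('a \<Rightarrow> complex) \<Rightarrow> complex"

definition fnorm :: "'a fun_space \<Rightarrow> ('a \<Rightarrow> complex) \<Rightarrow> real" where
  "fnorm E f = sqrt (Re (finner E f f))"

text \<open>Inner products are linear in the first argument.\<close>

definition is_fun_hilbert_space :: "'a set \<Rightarrow> 'a fun_space \<Rightarrow> bool" where
  "is_fun_hilbert_space X E \<longleftrightarrow>
     cfun.subspace (fcarrier E) \<and>
     (\<forall>f\<in>fcarrier E. \<forall>x. x \<notin> X \<longrightarrow> f x = 0) \<and>
     (\<forall>f\<in>fcarrier E. \<forall>g\<in>fcarrier E. \<forall>h\<in>fcarrier E.
        finner E (f + g) h = finner E f h + finner E g h) \<and>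
     (\<forall>c. \<forall>f\<in>fcarrier E. \<forall>g\<in>fcarrier E. finner E (cscale c f) g = c * finner E f g) \<and>
     (\<forall>f\<in>fcarrier E. \<forall>g\<in>fcarrier E. finner E g f = cnj (finner E f g)) \<and>
     (\<forall>f\<in>fcarrier E. f \<noteq> 0 \<longrightarrow> Re (finner E f f) > 0) \<and>
     (\<forall>s :: nat \<Rightarrow> 'a \<Rightarrow> complex.
        (\<forall>n. s n \<in> fcarrier E) \<and>
        (\<forall>e>0. \<exists>N. \<forall>m\<ge>N. \<forall>n\<ge>N. fnorm E (s m - s n) < e) \<longrightarrow>
        (\<exists>f\<in>fcarrier E. (\<lambda>n. fnorm E (s n - f)) \<longlonglongrightarrow> 0))"

definition kernel_fun :: "'a set \<Rightarrow> ('a \<Rightarrow> 'a \<Rightarrow> complex) \<Rightarrow> 'a \<Rightarrow> 'a \<Rightarrow> complex" where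
  "kernel_fun X k y = restr X (\<lambda>x. k x y)"

definition is_rkhs :: "'a set \<Rightarrow> ('a \<Rightarrow> 'a \<Rightarrow> complex) \<Rightarrow> 'a fun_space \<Rightarrow> bool" where
  "is_rkhs X k E \<longleftrightarrow>
     is_fun_hilbert_space X E \<and>
     (\<forall>y\<in>X. kernel_fun X k y \<in> fcarrier E \<and>
        (\<forall>f\<in>fcarrier E. f y = finner E f (kernel_fun X k y)))"

definition cinner :: "complex ^ 'd \<Rightarrow> complex ^ 'd \<Rightarrow> complex" where
  "cinner x y = (\<Sum>i\<in>UNIV. x $ i * cnj (y $ i))"

definition da_kernel :: "complex ^ 'd \<Rightarrow> complex ^ 'd \<Rightarrow> complex" where
  "da_kernel x y = 1 / (1 - cinner x y)"

text \<open>A reproducing kernel Hilbert space is determined by its kernel, up to the irrelevant values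
  of \<open>finner\<close> outside the carrier.\<close>

definition is_drury_arveson :: "(complex ^ 'd) fun_space \<Rightarrow> bool" where
  "is_drury_arveson D \<longleftrightarrow> is_rkhs (ball 0 1) da_kernel D"

definition is_variety :: "(complex ^ 'd) fun_space \<Rightarrow> (complex ^ 'd) set \<Rightarrow> bool" where
  "is_variety D V \<longleftrightarrow>
     (\<exists>F. F \<noteq> {} \<and> F \<subseteq> fcarrier D \<and> V = {x \<in> ball 0 1. \<forall>f\<in>F. f x = 0})"

definition kernel_closed_span ::
    "(complex ^ 'd) fun_space \<Rightarrow> (complex ^ 'd) set \<Rightarrow> (complex ^ 'd \<Rightarrow> complex) set" where
  "kernel_closed_span D V =
     {h \<in> fcarrier D. \<forall>e>0. \<exists>g\<in>cfun.span (kernel_fun (ball 0 1) da_kernel ` V). fnorm D (h - g) < e}"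

text \<open>
  The space \<open>H\<^sub>V\<close>, realised as a space of functions on \<open>V\<close>. Restriction to \<open>V\<close> is injective on the
  closed span, because a function vanishing on \<open>V\<close> is orthogonal to every \<open>k\<^sub>x\<close> with \<open>x \<in> V\<close>; the
  inner product is transported along it.
\<close>

definition HV :: "(complex ^ 'd) fun_space \<Rightarrow> (complex ^ 'd) set \<Rightarrow> (complex ^ 'd) fun_space" where
  "HV D V =
     \<lparr>fcarrier = restr V ` kernel_closed_span D V,
      finner = (\<lambda>f g. finner D (inv_into (kernel_closed_span D V) (restr V) f)
                              (inv_into (kernel_closed_span D V) (restr V) g))\<rparr>"

definition mult_alg ::
    "(complex ^ 'd) fun_space \<Rightarrow> (complex ^ 'd) set \<Rightarrow> (complex ^ 'd \<Rightarrow> complex) set" where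
  "mult_alg D V =
     {f. (\<forall>x. x \<notin> V \<longrightarrow> f x = 0) \<and> (\<forall>h\<in>fcarrier (HV D V). f * h \<in> fcarrier (HV D V))}"

text \<open>
  The norm of the operator \<open>\<Oplus>\<^sub>j E \<rightarrow> \<Oplus>\<^sub>i E\<close> (\<open>j \<in> J\<close>, \<open>i \<in> I\<close>, both finite) given by the matrix of
  multiplication operators with symbols \<open>A i j\<close>. All operator norms take values in \<open>[0, \<infinity>]\<close>, so that
  suprema are meaningful without a prior proof of boundedness.
\<close>

definition op_norm ::
    "'a fun_space \<Rightarrow> 'i set \<Rightarrow> 'j set \<Rightarrow> ('i \<Rightarrow> 'j \<Rightarrow> 'a \<Rightarrow> complex) \<Rightarrow> ennreal" where
  "op_norm E I J A =
     (SUP h \<in> {h. (\<forall>j\<in>J. h j \<in> fcarrier E) \<and> (\<Sum>j\<in>J. (fnorm E (h j))\<^sup>2) \<le> 1}.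
        ennreal (sqrt (\<Sum>i\<in>I. (fnorm E (\<Sum>j\<in>J. A i j * h j))\<^sup>2)))"

definition mat_norm ::
    "(complex ^ 'd) fun_space \<Rightarrow> (complex ^ 'd) set \<Rightarrow> nat \<Rightarrow>
     (nat \<Rightarrow> nat \<Rightarrow> complex ^ 'd \<Rightarrow> complex) \<Rightarrow> ennreal" where
  "mat_norm D V n A = op_norm (HV D V) {..<n} {..<n} A"

text \<open>The norm of the entrywise map \<open>\<phi>\<^sup>(\<^sup>n\<^sup>) : M\<^sub>n(\<M>\<^sub>V) \<rightarrow> M\<^sub>n(\<M>\<^sub>W)\<close>.\<close>

definition amp_norm ::
    "(complex ^ 'd) fun_space \<Rightarrow> (complex ^ 'd) set \<Rightarrow> (complex ^ 'd) set \<Rightarrow> nat \<Rightarrow>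
     ((complex ^ 'd \<Rightarrow> complex) \<Rightarrow> complex ^ 'd \<Rightarrow> complex) \<Rightarrow> ennreal" where
  "amp_norm D V W n \<phi> =
     (SUP A \<in> {A. (\<forall>i<n. \<forall>j<n. A i j \<in> mult_alg D V) \<and> mat_norm D V n A \<le> 1}.
        mat_norm D W n (\<lambda>i j. \<phi> (A i j)))"

definition cb_norm ::
    "(complex ^ 'd) fun_space \<Rightarrow> (complex ^ 'd) set \<Rightarrow> (complex ^ 'd) set \<Rightarrow>
     ((complex ^ 'd \<Rightarrow> complex) \<Rightarrow> complex ^ 'd \<Rightarrow> complex) \<Rightarrow> ennreal" where
  "cb_norm D V W \<phi> = (SUP n. amp_norm D V W n \<phi>)"

text \<open>A vector valued multiplier \<open>(f\<^sub>1, \<dots>, f\<^sub>d)\<close> on \<open>V\<close> is encoded as a map into \<open>\<complex>\<^sup>d\<close>; its norm is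
  that of the row operator, that is, of a matrix with a single row.\<close>

definition mult_norm ::
    "(complex ^ 'd) fun_space \<Rightarrow> (complex ^ 'd) set \<Rightarrow> (complex ^ 'd \<Rightarrow> complex ^ 'd) \<Rightarrow> ennreal" where
  "mult_norm D V F = op_norm (HV D V) (UNIV :: unit set) (UNIV :: 'd set) (\<lambda>_ j. restr V (\<lambda>x. F x $ j))"

definition mult_alg_iso ::
    "(complex ^ 'd) fun_space \<Rightarrow> (complex ^ 'd) set \<Rightarrow> (complex ^ 'd) set \<Rightarrow>
     ((complex ^ 'd \<Rightarrow> complex) \<Rightarrow> complex ^ 'd \<Rightarrow> complex) \<Rightarrow> bool" where
  "mult_alg_iso D V W \<phi> \<longleftrightarrow>
     bij_betw \<phi> (mult_alg D V) (mult_alg D W) \<and>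
     (\<forall>f\<in>mult_alg D V. \<forall>g\<in>mult_alg D V. \<phi> (f + g) = \<phi> f + \<phi> g \<and> \<phi> (f * g) = \<phi> f * \<phi> g) \<and>
     (\<forall>c. \<forall>f\<in>mult_alg D V. \<phi> (cscale c f) = cscale c (\<phi> f)) \<and>
     cb_norm D V W \<phi> < \<infinity> \<and>
     cb_norm D W V (inv_into (mult_alg D V) \<phi>) < \<infinity> \<and>
     (\<exists>G. bij_betw G W V \<and> (\<forall>f\<in>mult_alg D V. \<phi> f = restr W (f \<circ> G)))"

text \<open>The map \<open>G\<^sub>\<phi> = (\<phi>(Z\<^sub>1|\<^sub>V), \<dots>, \<phi>(Z\<^sub>d|\<^sub>V))\<close>.\<close>

definition coord_map ::
    "(complex ^ 'd) set \<Rightarrow> ((complex ^ 'd \<Rightarrow> complex) \<Rightarrow> complex ^ 'd \<Rightarrow> complex) \<Rightarrow>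
     complex ^ 'd \<Rightarrow> complex ^ 'd" where
  "coord_map V \<phi> = (\<lambda>x. \<chi> i. \<phi> (restr V (\<lambda>z. z $ i)) x)"

end

theory Submission
  imports Defs
begin

text \<open>
  The row \<open>Z = (Z\<^sub>1, \<dots>, Z\<^sub>d)\<close> is a contraction on every \<open>H\<^sub>V\<close>, and padding it with zero rows to a
  square matrix gives \<open>\<parallel>G\<^sub>\<phi>\<parallel> \<le> \<parallel>\<phi>\<^sup>(\<^sup>d\<^sup>)\<parallel>\<close>; this is the upper bound. For the lower bound let \<open>\<rho>\<close> be the
  pseudohyperbolic distance of the ball and fix \<open>x \<noteq> y\<close> in \<open>V\<close>. Applying \<open>\<phi>\<^sub>n\<close> and its inverse to
  the contractive row given by a ball automorphism that vanishes at one of the two points, and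
  evaluating at the other one, yields \<open>\<rho>(G\<^sub>n\<^sup>-\<^sup>1 x, G\<^sub>n\<^sup>-\<^sup>1 y) \<longlonglongrightarrow> \<rho>(x, y)\<close>. On the other hand, by the Schwarz-Pick
  inequality, a row multiplier of norm at most \<open>c < 1\<close> contracts \<open>\<rho>\<^sup>2 / (1 - \<rho>\<^sup>2)\<close> by the factor
  \<open>c\<^sup>2\<close>, so the norm of neither \<open>G\<^sub>n\<close> nor its inverse can stay below \<open>c\<close>.
\<close>

section \<open>Hilbert spaces of functions\<close>

locale fun_hilbert =
  fixes X :: "'a set" and E :: "'a fun_space"
  assumes hilbert: "is_fun_hilbert_space X E"
begin

abbreviation H :: "('a \<Rightarrow> complex) set" where "H \<equiv> fcarrier E"
abbreviation ip :: "('a \<Rightarrow> complex) \<Rightarrow> ('a \<Rightarrow> complex) \<Rightarrow> complex" where "ip \<equiv> finner E"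
abbreviation nrm :: "('a \<Rightarrow> complex) \<Rightarrow> real" where "nrm \<equiv> fnorm E"

lemma subspace_carrier: "cfun.subspace H"
  using hilbert unfolding is_fun_hilbert_space_def by blast

lemma carrier_zero [simp]: "0 \<in> H"
  using cfun.subspace_0[OF subspace_carrier] .

lemma carrier_add [simp]: "f \<in> H \<Longrightarrow> g \<in> H \<Longrightarrow> f + g \<in> H"
  using cfun.subspace_add[OF subspace_carrier] .

lemma carrier_diff [simp]: "f \<in> H \<Longrightarrow> g \<in> H \<Longrightarrow> f - g \<in> H"
  using cfun.subspace_diff[OF subspace_carrier] .

lemma carrier_scale [simp]: "f \<in> H \<Longrightarrow> cscale c f \<in> H"
  using cfun.subspace_scale[OF subspace_carrier] .

lemma carrier_sum [simp]: "(\<And>i. i \<in> I \<Longrightarrow> f i \<in> H) \<Longrightarrow> (\<Sum>i\<in>I. f i) \<in> H"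
  using cfun.subspace_sum[OF subspace_carrier] .

lemma carrier_outside: "f \<in> H \<Longrightarrow> x \<notin> X \<Longrightarrow> f x = 0"
  using hilbert unfolding is_fun_hilbert_space_def by blast

lemma ip_add_left [simp]:
  "f \<in> H \<Longrightarrow> g \<in> H \<Longrightarrow> h \<in> H \<Longrightarrow> ip (f + g) h = ip f h + ip g h"
  using hilbert unfolding is_fun_hilbert_space_def by blast

lemma ip_scale_left [simp]: "f \<in> H \<Longrightarrow> g \<in> H \<Longrightarrow> ip (cscale c f) g = c * ip f g"
  using hilbert unfolding is_fun_hilbert_space_def by blast

lemma ip_cnj: "f \<in> H \<Longrightarrow> g \<in> H \<Longrightarrow> ip g f = cnj (ip f g)"
  using hilbert unfolding is_fun_hilbert_space_def by blast

lemma ip_pos: "f \<in> H \<Longrightarrow> f \<noteq> 0 \<Longrightarrow> Re (ip f f) > 0"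
  using hilbert unfolding is_fun_hilbert_space_def by blast

lemma complete:
  assumes "\<And>n. s n \<in> H" "\<And>e. e > 0 \<Longrightarrow> \<exists>N. \<forall>m\<ge>N. \<forall>n\<ge>N. nrm (s m - s n) < e"
  obtains f where "f \<in> H" "(\<lambda>n. nrm (s n - f)) \<longlonglongrightarrow> 0"
  using hilbert assms unfolding is_fun_hilbert_space_def by blast

lemma ip_add_right [simp]:
  "f \<in> H \<Longrightarrow> g \<in> H \<Longrightarrow> h \<in> H \<Longrightarrow> ip h (f + g) = ip h f + ip h g"
  by (metis carrier_add complex_cnj_add ip_add_left ip_cnj)

lemma ip_scale_right [simp]: "f \<in> H \<Longrightarrow> g \<in> H \<Longrightarrow> ip g (cscale c f) = cnj c * ip g f"
  by (metis carrier_scale complex_cnj_mult ip_scale_left ip_cnj)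

lemma ip_zero_left [simp]: "f \<in> H \<Longrightarrow> ip 0 f = 0"
  using ip_add_left[of 0 0 f] by simp

lemma ip_zero_right [simp]: "f \<in> H \<Longrightarrow> ip f 0 = 0"
  using ip_add_right[of 0 0 f] by simp

lemma ip_diff_left [simp]:
  "f \<in> H \<Longrightarrow> g \<in> H \<Longrightarrow> h \<in> H \<Longrightarrow> ip (f - g) h = ip f h - ip g h"
  using ip_add_left[of "f - g" g h] by (simp add: algebra_simps)

lemma ip_diff_right [simp]:
  "f \<in> H \<Longrightarrow> g \<in> H \<Longrightarrow> h \<in> H \<Longrightarrow> ip h (f - g) = ip h f - ip h g"
  using ip_add_right[of "f - g" g h] by (simp add: algebra_simps)

lemma ip_sum_left:
  "(\<And>i. i \<in> I \<Longrightarrow> f i \<in> H) \<Longrightarrow> g \<in> H \<Longrightarrow> ip (\<Sum>i\<in>I. f i) g = (\<Sum>i\<in>I. ip (f i) g)"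
  by (induction I rule: infinite_finite_induct) auto

lemma ip_sum_right:
  "(\<And>i. i \<in> I \<Longrightarrow> f i \<in> H) \<Longrightarrow> g \<in> H \<Longrightarrow> ip g (\<Sum>i\<in>I. f i) = (\<Sum>i\<in>I. ip g (f i))"
  by (induction I rule: infinite_finite_induct) auto

lemma Im_ip_self [simp]: "f \<in> H \<Longrightarrow> Im (ip f f) = 0"
  by (metis ip_cnj cnj.simps(2) neg_equal_zero)

lemma Re_ip_self_nonneg: "f \<in> H \<Longrightarrow> Re (ip f f) \<ge> 0"
  using ip_pos[of f] by (cases "f = 0") auto

lemma nrm_nonneg [simp]: "f \<in> H \<Longrightarrow> nrm f \<ge> 0"
  by (simp add: fnorm_def Re_ip_self_nonneg)

lemma nrm_power2: "f \<in> H \<Longrightarrow> (nrm f)\<^sup>2 = Re (ip f f)"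
  by (simp add: fnorm_def Re_ip_self_nonneg)

lemma ip_self: "f \<in> H \<Longrightarrow> ip f f = of_real ((nrm f)\<^sup>2)"
  by (simp add: complex_eq_iff nrm_power2)

lemma nrm_eq_0 [simp]: "f \<in> H \<Longrightarrow> nrm f = 0 \<longleftrightarrow> f = 0"
  using ip_pos[of f] by (cases "f = 0") (simp_all add: fnorm_def)

lemma nrm_zero [simp]: "nrm 0 = 0"
  by simp

lemma nrm_scale [simp]: "f \<in> H \<Longrightarrow> nrm (cscale c f) = cmod c * nrm f"
proof -
  assume f: "f \<in> H"
  have "(nrm (cscale c f))\<^sup>2 = Re ((c * cnj c) * ip f f)"
    using f by (simp add: nrm_power2 mult.assoc mult.left_commute)
  also have "\<dots> = (cmod c * nrm f)\<^sup>2"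
    using f by (simp add: ip_self complex_mult_cnj cmod_power2 power_mult_distrib)
  finally show ?thesis using f by (simp add: power2_eq_iff_nonneg)
qed

lemma nrm_add_scale_power2:
  assumes "f \<in> H" "g \<in> H"
  shows "(nrm (f + cscale c g))\<^sup>2 = (nrm f)\<^sup>2 + 2 * Re (c * ip g f) + (cmod c)\<^sup>2 * (nrm g)\<^sup>2"
proof -
  have "ip f g = cnj (ip g f)" using ip_cnj assms by blast
  then show ?thesis
    using assms by (simp add: nrm_power2 cmod_power2) (simp add: power2_eq_square algebra_simps)
qed

lemma parallelogram:
  assumes "f \<in> H" "g \<in> H"
  shows "(nrm (f - g))\<^sup>2 + (nrm (f + g))\<^sup>2 = 2 * (nrm f)\<^sup>2 + 2 * (nrm g)\<^sup>2"
  using assms by (simp add: nrm_power2)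

section \<open>Cauchy-Schwarz, the triangle inequality and continuity of the inner product\<close>

lemma cauchy_schwarz:
  assumes "f \<in> H" "g \<in> H"
  shows "cmod (ip f g) \<le> nrm f * nrm g"
proof (cases "g = 0")
  case False
  then have pos: "nrm g > 0" using assms by (metis nrm_eq_0 nrm_nonneg less_eq_real_def)
  \<comment> \<open>With this \<open>c\<close>, \<open>f + cscale c g\<close> is the component of
    \<open>f\<close> orthogonal to \<open>g\<close>.\<close>
  define c where "c = - ip f g / of_real ((nrm g)\<^sup>2)"
  have "ip g f = cnj (ip f g)" using ip_cnj assms by blast
  then have "c * ip g f = - of_real ((cmod (ip f g))\<^sup>2) / of_real ((nrm g)\<^sup>2)"
    by (simp only: c_def complex_norm_square) simp
  then have 1: "Re (c * ip g f) = - (cmod (ip f g))\<^sup>2 / (nrm g)\<^sup>2"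
    by (metis Re_complex_of_real of_real_divide of_real_minus)
  have 2: "(cmod c)\<^sup>2 * (nrm g)\<^sup>2 = (cmod (ip f g))\<^sup>2 / (nrm g)\<^sup>2"
    using pos by (simp add: c_def norm_divide norm_power norm_mult power_divide power2_eq_square)
  have "0 \<le> (nrm (f + cscale c g))\<^sup>2" by simp
  also have "\<dots> = (nrm f)\<^sup>2 - (cmod (ip f g))\<^sup>2 / (nrm g)\<^sup>2"
    unfolding nrm_add_scale_power2[OF assms] 1 2 by simp
  finally have "(cmod (ip f g))\<^sup>2 \<le> (nrm f * nrm g)\<^sup>2"
    using pos by (simp add: power_mult_distrib pos_divide_le_eq)
  then show ?thesis by (rule power2_le_imp_le) (use assms in simp)
qed (use assms in simp)

lemma nrm_triangle:
  assumes "f \<in> H" "g \<in> H"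
  shows "nrm (f + g) \<le> nrm f + nrm g"
proof (rule power2_le_imp_le)
  have "Re (ip g f) \<le> nrm g * nrm f"
    using cauchy_schwarz[OF assms(2,1)] complex_Re_le_cmod order_trans by blast
  then show "(nrm (f + g))\<^sup>2 \<le> (nrm f + nrm g)\<^sup>2"
    using nrm_add_scale_power2[OF assms, of 1] by (simp add: cscale_def power2_sum mult.commute)
qed (use assms in simp)

lemma nrm_minus_commute: "f \<in> H \<Longrightarrow> g \<in> H \<Longrightarrow> nrm (f - g) = nrm (g - f)"
  by (simp add: fnorm_def)

lemma nrm_triangle_diff:
  assumes "f \<in> H" "g \<in> H" "h \<in> H"
  shows "nrm (f - h) \<le> nrm (f - g) + nrm (g - h)"
  using nrm_triangle[of "f - g" "g - h"] assms by simp

lemma tendsto_ip_right: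
  assumes "\<And>n. s n \<in> H" "f \<in> H" "g \<in> H" "(\<lambda>n. nrm (s n - f)) \<longlonglongrightarrow> 0"
  shows "(\<lambda>n. ip g (s n)) \<longlonglongrightarrow> ip g f"
proof (rule LIM_zero_cancel, rule Lim_null_comparison)
  have "norm (ip g (s n) - ip g f) \<le> nrm g * nrm (s n - f)" for n
    using assms cauchy_schwarz[of g "s n - f"] by simp
  then show "\<forall>\<^sub>F n in sequentially. norm (ip g (s n) - ip g f) \<le> nrm g * nrm (s n - f)"
    by simp
  show "(\<lambda>n. nrm g * nrm (s n - f)) \<longlonglongrightarrow> 0"
    using tendsto_mult_right_zero[OF assms(4)] .
qed

lemma tendsto_nrm:
  assumes "\<And>n. s n \<in> H" "f \<in> H" "(\<lambda>n. nrm (s n - f)) \<longlonglongrightarrow> 0"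
  shows "(\<lambda>n. nrm (s n)) \<longlonglongrightarrow> nrm f"
proof (rule LIM_zero_cancel, rule Lim_null_comparison[OF _ assms(3)])
  have "norm (nrm (s n) - nrm f) \<le> nrm (s n - f)" for n
    using nrm_triangle[of "s n - f" f] nrm_triangle[of "f - s n" "s n"] assms
      nrm_minus_commute[of f "s n"] by simp
  then show "\<forall>\<^sub>F n in sequentially. norm (nrm (s n) - nrm f) \<le> nrm (s n - f)" by simp
qed

text \<open>The functional is given by its graph, so that its values on a spanning set can be
  prescribed without checking that they are well defined.\<close>

lemma riesz:
  assumes S: "S \<subseteq> H \<times> UNIV" "(g0, l0) \<in> S"
    and add: "\<And>g l g' l'. (g, l) \<in> S \<Longrightarrow> (g', l') \<in> S \<Longrightarrow> (g + g', l + l') \<in> S"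
    and scale: "\<And>c g l. (g, l) \<in> S \<Longrightarrow> (cscale c g, c * l) \<in> S"
    and bound: "\<And>g l. (g, l) \<in> S \<Longrightarrow> cmod l \<le> C * nrm g"
    and C: "C \<ge> 0"
  obtains h where "h \<in> H" "nrm h \<le> C" "\<And>g l. (g, l) \<in> S \<Longrightarrow> ip g h = l"
proof -
  \<comment> \<open>If \<open>l = ip g h\<close>, then \<open>J (g, l)\<close> is the squared
    distance from \<open>g\<close> to \<open>h\<close> up to an additive constant, so
    \<open>h\<close> is sought as the limit of a minimising sequence.\<close>
  define J where "J = (\<lambda>(g, l). (nrm g)\<^sup>2 - 2 * Re l)"
  define m where "m = Inf (J ` S)"
  have SH: "g \<in> H" if "(g, l) \<in> S" for g l using S(1) that by auto
  have J_lower: "- C\<^sup>2 \<le> J p" if "p \<in> S" for p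
  proof -
    obtain g l where p: "p = (g, l)" by force
    have "Re l \<le> C * nrm g"
      using bound[of g l] complex_Re_le_cmod[of l] that p by simp
    then have "J p + C\<^sup>2 \<ge> (nrm g - C)\<^sup>2"
      by (simp add: J_def p power2_diff mult.commute)
    then show ?thesis using zero_le_power2[of "nrm g - C"] by linarith
  qed
  then have bdd: "bdd_below (J ` S)" by (auto intro!: bdd_belowI2)
  have m_le: "m \<le> J p" if "p \<in> S" for p
    unfolding m_def using cInf_lower[OF _ bdd] that by blast
  have "\<exists>p\<in>S. J p < m + 1 / real (Suc n)" for n
  proof -
    have "J ` S \<noteq> {}" using S(2) by blast
    then show ?thesis
      using cInf_lessD[of "J ` S" "m + 1 / real (Suc n)"] unfolding m_def by auto
  qed
  then obtain p where p: "\<And>n. p n \<in> S" "\<And>n. J (p n) < m + 1 / real (Suc n)" by metis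
  define g where "g = (\<lambda>n. fst (p n))"
  define l where "l = (\<lambda>n. snd (p n))"
  have gl: "(g n, l n) \<in> S" and Jn: "(nrm (g n))\<^sup>2 - 2 * Re (l n) < m + 1 / real (Suc n)" for n
    using p[of n] by (simp_all add: g_def l_def J_def split: prod.splits)
  have gH [simp]: "g n \<in> H" for n using SH gl by blast
  \<comment> \<open>The midpoint of two members of the sequence stays in \<open>S\<close>, so
    \<open>J\<close> is at least \<open>m\<close> there; the parallelogram law turns this into a
    Cauchy estimate.\<close>
  have close: "(nrm (g i - g j))\<^sup>2 \<le> 2 / real (Suc i) + 2 / real (Suc j)" for i j
  proof -
    have "m \<le> J (cscale (1/2) (g i + g j), (1/2) * (l i + l j))"
      by (intro m_le scale add gl)
    then have "m \<le> (nrm (g i + g j))\<^sup>2 / 4 - Re (l i + l j)"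
      by (simp add: J_def power_mult_distrib norm_divide power_divide add_divide_distrib)
    then show ?thesis using parallelogram[of "g i" "g j"] Jn[of i] Jn[of j]
      by simp
  qed
  have "\<exists>N. \<forall>i\<ge>N. \<forall>j\<ge>N. nrm (g i - g j) < e" if "e > 0" for e
  proof -
    obtain N where N: "1 / real (Suc N) < e\<^sup>2 / 4"
      by (rule nat_approx_posE[of "e\<^sup>2 / 4"]) (use \<open>e > 0\<close> in auto)
    have "nrm (g i - g j) < e" if ij: "i \<ge> N" "j \<ge> N" for i j
    proof (rule power2_less_imp_less)
      have "1 / real (Suc i) \<le> 1 / real (Suc N)" "1 / real (Suc j) \<le> 1 / real (Suc N)"
        using ij by (auto intro!: divide_left_mono)
      then show "(nrm (g i - g j))\<^sup>2 < e\<^sup>2" using close[of i j] N by linarith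
    qed (use \<open>e > 0\<close> in simp)
    then show ?thesis by blast
  qed
  then obtain h where h: "h \<in> H" "(\<lambda>n. nrm (g n - h)) \<longlonglongrightarrow> 0"
    using complete[of g] gH by metis
  have eq: "ip g' h = l'" if g': "(g', l') \<in> S" for g' l'
  proof -
    have g'H: "g' \<in> H" using SH g' .
    define z where "z = ip g' h - l'"
    \<comment> \<open>First variation: moving \<open>g n\<close> by \<open>cscale t g'\<close>
      cannot push \<open>J\<close> below \<open>m\<close>, and the error
      \<open>1 / real (Suc n)\<close> vanishes in the limit.\<close>
    have ineq: "0 \<le> 2 * Re (t * z) + (cmod t)\<^sup>2 * (nrm g')\<^sup>2" for t
    proof -
      have "- (1 / real (Suc n)) \<le> 2 * Re (t * (ip g' (g n) - l')) + (cmod t)\<^sup>2 * (nrm g')\<^sup>2" for n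
      proof -
        have "m \<le> J (g n + cscale t g', l n + t * l')" by (intro m_le scale add gl g')
        then show ?thesis
          using Jn[of n] by (simp add: J_def nrm_add_scale_power2 g'H algebra_simps)
      qed
      moreover have "(\<lambda>n. 2 * Re (t * (ip g' (g n) - l')) + (cmod t)\<^sup>2 * (nrm g')\<^sup>2)
          \<longlonglongrightarrow> 2 * Re (t * z) + (cmod t)\<^sup>2 * (nrm g')\<^sup>2"
        unfolding z_def by (intro tendsto_intros tendsto_ip_right h g'H gH)
      moreover have "(\<lambda>n. - (1 / real (Suc n))) \<longlonglongrightarrow> 0"
        using tendsto_minus[OF LIMSEQ_inverse_real_of_nat] by (simp add: inverse_eq_divide)
      ultimately show ?thesis by (meson LIMSEQ_le)
    qed
    \<comment> \<open>For \<open>t = - e * cnj z\<close> the linear term is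
      \<open>- 2 * e * (cmod z)\<^sup>2\<close>. This \<open>e\<close> keeps the quadratic term at
      most half as large; the \<open>+ 1\<close> covers \<open>g' = 0\<close>.\<close>
    define e where "e = 1 / ((nrm g')\<^sup>2 + 1)"
    have e: "e > 0" "e * (nrm g')\<^sup>2 \<le> 1"
      by (auto simp: e_def add_nonneg_pos divide_simps)
    have "0 \<le> 2 * Re (- of_real e * cnj z * z) + (cmod (- of_real e * cnj z))\<^sup>2 * (nrm g')\<^sup>2"
      by (rule ineq)
    also have "Re (- of_real e * cnj z * z) = - e * (cmod z)\<^sup>2"
      by (simp add: cmod_power2) (simp add: power2_eq_square algebra_simps)
    also have "(cmod (- of_real e * cnj z))\<^sup>2 * (nrm g')\<^sup>2 = e * (cmod z)\<^sup>2 * (e * (nrm g')\<^sup>2)"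
      by (simp add: norm_mult power2_eq_square)
    also have "\<dots> \<le> e * (cmod z)\<^sup>2 * 1"
      using e by (intro mult_left_mono) auto
    finally have "e * (cmod z)\<^sup>2 \<le> 0" by simp
    then have "z = 0" using e(1) by (simp add: mult_le_0_iff)
    then show ?thesis by (simp add: z_def)
  qed
  \<comment> \<open>\<open>h\<close> is the limit of the \<open>g n\<close>, each of which obeys the
    bound assumed on \<open>S\<close>.\<close>
  have "cmod (ip h h) \<le> C * nrm h"
  proof (rule LIMSEQ_le)
    show "(\<lambda>n. cmod (ip h (g n))) \<longlonglongrightarrow> cmod (ip h h)"
      by (intro tendsto_intros tendsto_ip_right h gH)
    show "(\<lambda>n. C * nrm (g n)) \<longlonglongrightarrow> C * nrm h"
      by (intro tendsto_intros tendsto_nrm h gH)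
    have "cmod (ip h (g n)) \<le> C * nrm (g n)" for n
      using bound[OF gl] eq[OF gl] ip_cnj[OF gH h(1)] by simp
    then show "\<exists>N. \<forall>n\<ge>N. cmod (ip h (g n)) \<le> C * nrm (g n)" by blast
  qed
  then have "nrm h * nrm h \<le> C * nrm h"
    using h(1) by (simp add: ip_self norm_mult power2_eq_square)
  then have "nrm h \<le> C"
    using nrm_nonneg[OF h(1)] C by (cases "nrm h = 0") auto
  with h(1) eq show thesis using that by blast
qed

end

section \<open>Norms of rows of multiplication operators\<close>

text \<open>The form is tested on vectors whose phase makes the cross term real; what results is the
  positivity criterion for Hermitian matrices of size two.\<close>

lemma hermitian_form_2:
  fixes b :: complex and a d :: real
  assumes form: "\<And>s t. 0 \<le> a * (cmod s)\<^sup>2 + d * (cmod t)\<^sup>2 + 2 * Re (cnj s * t * b)"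
  shows "0 \<le> a" "(cmod b)\<^sup>2 \<le> a * d"
proof -
  show a: "0 \<le> a" using form[of 1 0] by simp
  have d: "0 \<le> d" using form[of 0 1] by simp
  have form': "0 \<le> a * s\<^sup>2 + d * (t * cmod b)\<^sup>2 - 2 * s * t * (cmod b)\<^sup>2" for s t :: real
  proof -
    have "cnj (of_real s) * (- of_real t * cnj b) * b = - of_real (s * t * (cmod b)\<^sup>2)"
      unfolding of_real_mult complex_norm_square by (simp add: algebra_simps)
    then have "Re (cnj (of_real s) * (- of_real t * cnj b) * b) = - (s * t * (cmod b)\<^sup>2)"
      by (metis Re_complex_of_real of_real_minus)
    with form[of "of_real s" "- of_real t * cnj b"] show ?thesis
      by (simp only:) (simp add: norm_mult power_mult_distrib)
  qed
  show "(cmod b)\<^sup>2 \<le> a * d"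
  proof (cases "d = 0")
    case True
    have "b = 0"
    proof (rule ccontr)
      assume "b \<noteq> 0"
      \<comment> \<open>With \<open>d = 0\<close> the form is affine in \<open>t\<close>, and this
        value of \<open>t\<close> makes it \<open>a - 2 * (a + 1) < 0\<close>.\<close>
      then show False using form'[of 1 "(a + 1) / (cmod b)\<^sup>2"] True a by simp
    qed
    with True show ?thesis by simp
  next
    case False
    then have "d > 0" using d by simp
    have "0 \<le> d * (a * d - (cmod b)\<^sup>2)"
      using form'[of d 1] by (simp add: power2_eq_square algebra_simps)
    with \<open>d > 0\<close> show ?thesis by (simp add: zero_le_mult_iff)
  qed
qed

lemma op_norm_reindex_le:
  assumes b: "bij_betw b J' J"
  shows "op_norm E I J A \<le> op_norm E I J' (\<lambda>i j. A i (b j))"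
  unfolding op_norm_def
proof (rule SUP_mono)
  fix h assume "h \<in> {h. (\<forall>j\<in>J. h j \<in> fcarrier E) \<and> (\<Sum>j\<in>J. (fnorm E (h j))\<^sup>2) \<le> 1}"
  then have h: "\<forall>j\<in>J. h j \<in> fcarrier E" "(\<Sum>j\<in>J. (fnorm E (h j))\<^sup>2) \<le> 1" by auto
  have "(\<Sum>j\<in>J'. (fnorm E (h (b j)))\<^sup>2) = (\<Sum>j\<in>J. (fnorm E (h j))\<^sup>2)"
    by (rule sum.reindex_bij_betw[OF b])
  moreover have "(\<Sum>j\<in>J'. A i (b j) * h (b j)) = (\<Sum>j\<in>J. A i j * h j)" for i
    by (rule sum.reindex_bij_betw[OF b])
  ultimately show "\<exists>h'\<in>{h. (\<forall>j\<in>J'. h j \<in> fcarrier E) \<and> (\<Sum>j\<in>J'. (fnorm E (h j))\<^sup>2) \<le> 1}.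
      ennreal (sqrt (\<Sum>i\<in>I. (fnorm E (\<Sum>j\<in>J. A i j * h j))\<^sup>2))
      \<le> ennreal (sqrt (\<Sum>i\<in>I. (fnorm E (\<Sum>j\<in>J'. A i (b j) * h' j))\<^sup>2))"
    using h bij_betwE[OF b] by (intro bexI[of _ "\<lambda>j. h (b j)"]) auto
qed

lemma op_norm_cong:
  assumes "\<And>i j. i \<in> I \<Longrightarrow> j \<in> J \<Longrightarrow> A i j = B i j"
  shows "op_norm E I J A = op_norm E I J B"
  unfolding op_norm_def using assms by (simp cong: sum.cong)

text \<open>The two estimates come from \<open>b\<close> and from its inverse. This links
  \<open>mat_norm\<close>, whose columns are numbered, to \<open>mult_norm\<close>, whose columns
  are indexed by \<open>'d\<close>.\<close>

lemma op_norm_reindex: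
  assumes b: "bij_betw b J' J"
  shows "op_norm E I J' (\<lambda>i j. A i (b j)) = op_norm E I J A"
proof (rule antisym)
  have "op_norm E I J' (\<lambda>i j. A i (b j)) \<le> op_norm E I J (\<lambda>i j. A i (b (inv_into J' b j)))"
    by (rule op_norm_reindex_le[OF bij_betw_inv_into[OF b]])
  also have "\<dots> = op_norm E I J A"
    by (rule op_norm_cong) (simp add: bij_betw_inv_into_right[OF b])
  finally show "op_norm E I J' (\<lambda>i j. A i (b j)) \<le> op_norm E I J A" .
qed (rule op_norm_reindex_le[OF b])

context fun_hilbert
begin

text \<open>Zero rows add nothing to the sum of squares, so padding a row with them keeps its
  norm.\<close>

lemma op_norm_single_row:
  assumes "finite I" "i0 \<in> I" "\<And>i j. i \<in> I \<Longrightarrow> i \<noteq> i0 \<Longrightarrow> j \<in> J \<Longrightarrow> A i j = 0"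
  shows "op_norm E I J A = op_norm E (UNIV :: unit set) J (\<lambda>_. A i0)"
proof -
  have "(\<Sum>i\<in>I. (nrm (\<Sum>j\<in>J. A i j * h j))\<^sup>2) = (nrm (\<Sum>j\<in>J. A i0 j * h j))\<^sup>2" for h
  proof -
    have "(\<Sum>i\<in>I. (nrm (\<Sum>j\<in>J. A i j * h j))\<^sup>2)
        = (\<Sum>i\<in>I. if i = i0 then (nrm (\<Sum>j\<in>J. A i0 j * h j))\<^sup>2 else 0)"
      using assms(3) by (intro sum.cong) auto
    then show ?thesis using assms(1,2) by simp
  qed
  then show ?thesis by (simp add: op_norm_def UNIV_unit)
qed

lemma op_norm_row_leI:
  assumes "\<And>h. (\<And>j. j \<in> J \<Longrightarrow> h j \<in> H) \<Longrightarrow>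
      nrm (\<Sum>j\<in>J. F j * h j) \<le> r * sqrt (\<Sum>j\<in>J. (nrm (h j))\<^sup>2)" and "r \<ge> 0"
    and "\<And>h. (\<And>j. j \<in> J \<Longrightarrow> h j \<in> H) \<Longrightarrow> (\<Sum>j\<in>J. F j * h j) \<in> H"
  shows "op_norm E (UNIV :: unit set) J (\<lambda>_. F) \<le> ennreal r"
  unfolding op_norm_def
proof (rule SUP_least)
  fix h assume "h \<in> {h. (\<forall>j\<in>J. h j \<in> H) \<and> (\<Sum>j\<in>J. (nrm (h j))\<^sup>2) \<le> 1}"
  then have h: "\<And>j. j \<in> J \<Longrightarrow> h j \<in> H" "(\<Sum>j\<in>J. (nrm (h j))\<^sup>2) \<le> 1" by auto
  have "nrm (\<Sum>j\<in>J. F j * h j) \<le> r * sqrt (\<Sum>j\<in>J. (nrm (h j))\<^sup>2)"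
    using assms(1) h(1) by blast
  also have "\<dots> \<le> r * 1" using h(2) \<open>r \<ge> 0\<close> by (intro mult_left_mono) auto
  finally show "ennreal (sqrt (\<Sum>i\<in>(UNIV :: unit set). (nrm (\<Sum>j\<in>J. F j * h j))\<^sup>2)) \<le> ennreal r"
    using assms(3)[OF h(1)] by (simp add: UNIV_unit ennreal_leI)
qed

text \<open>Homogeneity extends the supremum over the unit ball to all columns. \<open>FH\<close> is
  assumed because \<open>fnorm\<close> is only controlled on the carrier.\<close>

lemma op_norm_row_leD:
  assumes le: "op_norm E (UNIV :: unit set) J (\<lambda>_. F) \<le> ennreal r" and "r \<ge> 0" "finite J"
    and FH: "\<And>h. (\<And>j. j \<in> J \<Longrightarrow> h j \<in> H) \<Longrightarrow> (\<Sum>j\<in>J. F j * h j) \<in> H"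
    and h: "\<And>j. j \<in> J \<Longrightarrow> h j \<in> H"
  shows "nrm (\<Sum>j\<in>J. F j * h j) \<le> r * sqrt (\<Sum>j\<in>J. (nrm (h j))\<^sup>2)"
proof -
  define s where "s = sqrt (\<Sum>j\<in>J. (nrm (h j))\<^sup>2)"
  have s2: "s\<^sup>2 = (\<Sum>j\<in>J. (nrm (h j))\<^sup>2)" by (simp add: s_def sum_nonneg)
  have "s \<ge> 0" by (simp add: s_def sum_nonneg)
  show ?thesis
  proof (cases "s = 0")
    \<comment> \<open>A column of norm zero cannot be normalised, but its entries vanish.\<close>
    case True
    then have "\<forall>j\<in>J. (nrm (h j))\<^sup>2 = 0"
      using s2 \<open>finite J\<close> by (simp add: sum_nonneg_eq_0_iff)
    then have "\<forall>j\<in>J. h j = 0" using h by simp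
    then have "(\<Sum>j\<in>J. F j * h j) = 0" by (simp cong: sum.cong)
    then show ?thesis using True by (simp add: s_def)
  next
    case False
    then have "s > 0" using \<open>s \<ge> 0\<close> by simp
    define h' where "h' j = cscale (of_real (1 / s)) (h j)" for j
    have h'H: "h' j \<in> H" if "j \<in> J" for j using h that by (simp add: h'_def)
    have "(\<Sum>j\<in>J. (nrm (h' j))\<^sup>2) = (\<Sum>j\<in>J. (nrm (h j))\<^sup>2 / s\<^sup>2)"
      using h \<open>s > 0\<close> by (intro sum.cong) (auto simp: h'_def norm_divide power_divide)
    also have "\<dots> = 1"
      using \<open>s > 0\<close> by (simp add: sum_divide_distrib[symmetric] s2[symmetric])
    finally have "h' \<in> {h. (\<forall>j\<in>J. h j \<in> H) \<and> (\<Sum>j\<in>J. (nrm (h j))\<^sup>2) \<le> 1}"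
      using h'H by simp
    then have "ennreal (sqrt (\<Sum>i\<in>(UNIV :: unit set). (nrm (\<Sum>j\<in>J. F j * h' j))\<^sup>2)) \<le> ennreal r"
      by (rule order_trans[OF SUP_upper le[unfolded op_norm_def]])
    then have "nrm (\<Sum>j\<in>J. F j * h' j) \<le> r"
      using FH[OF h'H] \<open>r \<ge> 0\<close> by (simp add: UNIV_unit)
    moreover have "(\<Sum>j\<in>J. F j * h' j) = cscale (of_real (1 / s)) (\<Sum>j\<in>J. F j * h j)"
      unfolding cfun.scale_sum_right
      by (rule sum.cong) (auto simp: h'_def cscale_def fun_eq_iff)
    ultimately have "nrm (\<Sum>j\<in>J. F j * h j) / s \<le> r"
      using FH[OF h] \<open>s > 0\<close> by (simp add: norm_divide)
    then show ?thesis using \<open>s > 0\<close> by (simp add: s_def[symmetric] pos_divide_le_eq)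
  qed
qed

end

section \<open>Multipliers of reproducing kernel Hilbert spaces\<close>

locale rkhs =
  fixes X :: "'a set" and k :: "'a \<Rightarrow> 'a \<Rightarrow> complex" and E :: "'a fun_space"
  assumes rkhs: "is_rkhs X k E"

sublocale rkhs \<subseteq> fun_hilbert X E
  using rkhs by unfold_locales (simp add: is_rkhs_def)

context rkhs
begin

abbreviation K :: "'a \<Rightarrow> 'a \<Rightarrow> complex" where "K \<equiv> kernel_fun X k"

lemma K_carrier [simp]: "y \<in> X \<Longrightarrow> K y \<in> H"
  using rkhs by (simp add: is_rkhs_def)

lemma reproducing: "f \<in> H \<Longrightarrow> y \<in> X \<Longrightarrow> ip f (K y) = f y"
  using rkhs by (simp add: is_rkhs_def)

lemma reproducing_cnj: "f \<in> H \<Longrightarrow> y \<in> X \<Longrightarrow> ip (K y) f = cnj (f y)"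
  using ip_cnj[of f "K y"] reproducing[of f y] by simp

lemma ip_K_K: "x \<in> X \<Longrightarrow> y \<in> X \<Longrightarrow> ip (K y) (K x) = k x y"
  by (simp add: reproducing) (simp add: kernel_fun_def restr_def)

lemma nrm_kernel_sum:
  assumes "finite A" "A \<subseteq> X"
  shows "of_real ((nrm (\<Sum>y\<in>A. cscale (c y) (K y)))\<^sup>2)
    = (\<Sum>x\<in>A. \<Sum>y\<in>A. cnj (c x) * c y * k x y)"
proof -
  have A [simp]: "y \<in> A \<Longrightarrow> y \<in> X" for y using assms by auto
  have "of_real ((nrm (\<Sum>y\<in>A. cscale (c y) (K y)))\<^sup>2)
      = ip (\<Sum>y\<in>A. cscale (c y) (K y)) (\<Sum>x\<in>A. cscale (c x) (K x))"
    by (simp add: ip_self)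
  also have "\<dots> = (\<Sum>x\<in>A. \<Sum>y\<in>A. ip (cscale (c y) (K y)) (cscale (c x) (K x)))"
    by (simp add: ip_sum_left ip_sum_right sum_distrib_left)
  also have "\<dots> = (\<Sum>x\<in>A. \<Sum>y\<in>A. cnj (c x) * c y * k x y)"
    by (intro sum.cong) (auto simp: ip_K_K algebra_simps)
  finally show ?thesis .
qed

text \<open>By \<open>bound\<close>, sending each \<open>K y\<close> to \<open>cnj (f y)\<close>
  defines a bounded functional on the span of the kernel functions; its Riesz representative has the
  values of \<open>f\<close> by the reproducing property.\<close>

lemma mem_carrier_criterion:
  assumes out: "\<And>x. x \<notin> X \<Longrightarrow> f x = 0" and C: "C \<ge> 0"
    and bound: "\<And>A c. finite A \<Longrightarrow> A \<subseteq> X \<Longrightarrow>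
      cmod (\<Sum>y\<in>A. c y * cnj (f y)) \<le> C * nrm (\<Sum>y\<in>A. cscale (c y) (K y))"
  shows "f \<in> H" "nrm f \<le> C"
proof -
  define S where "S = {(\<Sum>y\<in>A. cscale (c y) (K y), \<Sum>y\<in>A. c y * cnj (f y)) |A c.
    finite A \<and> A \<subseteq> X}"
  have SI: "(\<Sum>y\<in>A. cscale (c y) (K y), \<Sum>y\<in>A. c y * cnj (f y)) \<in> S"
    if "finite A" "A \<subseteq> X" for A c using that unfolding S_def by blast
  have SE: "\<exists>A c. finite A \<and> A \<subseteq> X \<and> g = (\<Sum>y\<in>A. cscale (c y) (K y)) \<and> l = (\<Sum>y\<in>A. c y * cnj (f y))"
    if "(g, l) \<in> S" for g l using that unfolding S_def by blast
  \<comment> \<open>Padding the coefficients with zeros brings two combinations to the common index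
    set \<open>A \<union> B\<close>.\<close>
  have ext: "(\<Sum>y\<in>A. cscale (c y) (K y)) = (\<Sum>y\<in>B. cscale (if y \<in> A then c y else 0) (K y))"
      "(\<Sum>y\<in>A. c y * cnj (f y)) = (\<Sum>y\<in>B. (if y \<in> A then c y else 0) * cnj (f y))"
    if "finite B" "A \<subseteq> B" for A B c
    using that by (intro sum.mono_neutral_cong_left; simp)+
  obtain h where h: "h \<in> H" "nrm h \<le> C" "\<And>g l. (g, l) \<in> S \<Longrightarrow> ip g h = l"
  proof (rule riesz[of S 0 0 C])
    show "S \<subseteq> H \<times> UNIV"
      unfolding S_def by (auto intro!: carrier_sum carrier_scale K_carrier)
    show "(0, 0) \<in> S" using SI[of "{}"] by simp
    show "(g + g', l + l') \<in> S" if "(g, l) \<in> S" "(g', l') \<in> S" for g l g' l'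
    proof -
      obtain A c where A: "finite A" "A \<subseteq> X"
        and g: "g = (\<Sum>y\<in>A. cscale (c y) (K y))" "l = (\<Sum>y\<in>A. c y * cnj (f y))"
        using SE \<open>(g, l) \<in> S\<close> by blast
      obtain B d where B: "finite B" "B \<subseteq> X"
        and g': "g' = (\<Sum>y\<in>B. cscale (d y) (K y))" "l' = (\<Sum>y\<in>B. d y * cnj (f y))"
        using SE \<open>(g', l') \<in> S\<close> by blast
      define e where "e y = (if y \<in> A then c y else 0) + (if y \<in> B then d y else 0)" for y
      have "g + g' = (\<Sum>y\<in>A \<union> B. cscale (e y) (K y))"
        unfolding g g' e_def cfun.scale_left_distrib sum.distrib
        using A(1) B(1) by (intro arg_cong2[of _ _ _ _ plus] ext) auto
      moreover have "l + l' = (\<Sum>y\<in>A \<union> B. e y * cnj (f y))"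
        unfolding g g' e_def distrib_right sum.distrib
        using A(1) B(1) by (intro arg_cong2[of _ _ _ _ plus] ext) auto
      ultimately show ?thesis using SI[of "A \<union> B" e] A B by simp
    qed
    show "(cscale c g, c * l) \<in> S" if "(g, l) \<in> S" for c g l
    proof -
      obtain A d where A: "finite A" "A \<subseteq> X"
        and g: "g = (\<Sum>y\<in>A. cscale (d y) (K y))" "l = (\<Sum>y\<in>A. d y * cnj (f y))"
        using SE \<open>(g, l) \<in> S\<close> by blast
      show ?thesis using SI[OF A, of "\<lambda>y. c * d y"]
        by (simp add: g cfun.scale_sum_right sum_distrib_left mult.assoc)
    qed
    show "cmod l \<le> C * nrm g" if "(g, l) \<in> S" for g l
      using SE[OF that] bound by blast
  qed (use C in auto)
  have "f = h"
  proof
    fix x show "f x = h x"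
    proof (cases "x \<in> X")
      case True
      then have "(K x, cnj (f x)) \<in> S" using SI[of "{x}" "\<lambda>_. 1"] by simp
      then show ?thesis using h(3) reproducing_cnj[OF h(1) True] by simp
    next
      case False
      then show ?thesis using out carrier_outside[OF h(1)] by simp
    qed
  qed
  with h show "f \<in> H" "nrm f \<le> C" by auto
qed

text \<open>The adjoint of the row sends \<open>K y\<close> to the column of the
  \<open>cscale (cnj (F j y)) (K y)\<close>. The left side is the squared norm of the image of a
  combination of kernel functions.\<close>

lemma sum_nrm_kernel_sums:
  assumes A: "finite A" "A \<subseteq> X"
  shows "of_real (\<Sum>j\<in>J. (nrm (\<Sum>y\<in>A. cscale (c y * cnj (F j y)) (K y)))\<^sup>2)
    = (\<Sum>x\<in>A. \<Sum>y\<in>A. cnj (c x) * c y * ((\<Sum>j\<in>J. F j x * cnj (F j y)) * k x y))"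
proof -
  have "of_real (\<Sum>j\<in>J. (nrm (\<Sum>y\<in>A. cscale (c y * cnj (F j y)) (K y)))\<^sup>2)
      = (\<Sum>j\<in>J. \<Sum>x\<in>A. \<Sum>y\<in>A. cnj (c x) * F j x * (c y * cnj (F j y)) * k x y)"
    by (simp only: of_real_sum nrm_kernel_sum[OF A]) simp
  also have "\<dots> = (\<Sum>x\<in>A. \<Sum>j\<in>J. \<Sum>y\<in>A. cnj (c x) * F j x * (c y * cnj (F j y)) * k x y)"
    by (rule sum.swap)
  also have "\<dots> = (\<Sum>x\<in>A. \<Sum>y\<in>A. \<Sum>j\<in>J. cnj (c x) * F j x * (c y * cnj (F j y)) * k x y)"
    by (intro sum.cong refl sum.swap)
  also have "\<dots> = (\<Sum>x\<in>A. \<Sum>y\<in>A. cnj (c x) * c y * ((\<Sum>j\<in>J. F j x * cnj (F j y)) * k x y))"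
    by (intro sum.cong refl) (simp add: sum_distrib_left sum_distrib_right mult_ac)
  finally show ?thesis .
qed

text \<open>Identity minus row times adjoint has a positive kernel of rank one by
  \<open>kernel\<close>. Hence the adjoint contracts on combinations of kernel functions, and
  duality gives both membership and the bound.\<close>

lemma row_contraction:
  assumes kernel: "\<And>x y. x \<in> X \<Longrightarrow> y \<in> X \<Longrightarrow>
      (1 - (\<Sum>j\<in>J. F j x * cnj (F j y))) * k x y = g x * cnj (g y)"
    and h: "\<And>j. j \<in> J \<Longrightarrow> h j \<in> H"
  shows "(\<Sum>j\<in>J. F j * h j) \<in> H" "nrm (\<Sum>j\<in>J. F j * h j) \<le> sqrt (\<Sum>j\<in>J. (nrm (h j))\<^sup>2)"
proof -
  define f where "f = (\<Sum>j\<in>J. F j * h j)"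
  define s where "s = sqrt (\<Sum>j\<in>J. (nrm (h j))\<^sup>2)"
  have f: "f x = (\<Sum>j\<in>J. F j x * h j x)" for x
    unfolding f_def by (induction J rule: infinite_finite_induct) auto
  have "s \<ge> 0" by (simp add: s_def sum_nonneg)
  have out: "f x = 0" if "x \<notin> X" for x
    using carrier_outside[OF h that] by (simp add: f)
  have bound: "cmod (\<Sum>y\<in>A. c y * cnj (f y)) \<le> s * nrm (\<Sum>y\<in>A. cscale (c y) (K y))"
    if A: "finite A" "A \<subseteq> X" for A c
  proof -
    \<comment> \<open>The entries of the adjoint row applied to the combination with coefficients
      \<open>c\<close>.\<close>
    define u where "u j = (\<Sum>y\<in>A. cscale (c y * cnj (F j y)) (K y))" for j
    have AX [simp]: "y \<in> A \<Longrightarrow> y \<in> X" for y using A by auto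
    have uH: "u j \<in> H" for j by (simp add: u_def)
    have "(\<Sum>y\<in>A. c y * cnj (f y)) = (\<Sum>y\<in>A. \<Sum>j\<in>J. c y * cnj (F j y) * cnj (h j y))"
      by (simp add: f sum_distrib_left mult.assoc)
    also have "\<dots> = (\<Sum>j\<in>J. \<Sum>y\<in>A. c y * cnj (F j y) * cnj (h j y))"
      by (rule sum.swap)
    also have "\<dots> = (\<Sum>j\<in>J. ip (u j) (h j))"
      using h by (intro sum.cong refl) (simp add: u_def ip_sum_left reproducing_cnj)
    finally have "cmod (\<Sum>y\<in>A. c y * cnj (f y)) \<le> (\<Sum>j\<in>J. \<bar>nrm (u j)\<bar> * \<bar>nrm (h j)\<bar>)"
      using h uH by (auto intro!: sum_norm_le cauchy_schwarz)
    also have "\<dots> \<le> L2_set (\<lambda>j. nrm (u j)) J * L2_set (\<lambda>j. nrm (h j)) J"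
      by (rule L2_set_mult_ineq)
    also have "L2_set (\<lambda>j. nrm (h j)) J = s"
      by (simp add: L2_set_def s_def)
    also have "L2_set (\<lambda>j. nrm (u j)) J \<le> nrm (\<Sum>y\<in>A. cscale (c y) (K y))"
    proof -
      \<comment> \<open>The loss of squared norm under the adjoint collapses to one square because
        the kernel has rank one.\<close>
      have "of_real ((nrm (\<Sum>y\<in>A. cscale (c y) (K y)))\<^sup>2 - (\<Sum>j\<in>J. (nrm (u j))\<^sup>2))
          = (\<Sum>x\<in>A. \<Sum>y\<in>A. cnj (c x) * c y * ((1 - (\<Sum>j\<in>J. F j x * cnj (F j y))) * k x y))"
        unfolding u_def of_real_diff nrm_kernel_sum[OF A] sum_nrm_kernel_sums[OF A]
        by (simp add: sum_subtractf[symmetric] algebra_simps)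
      also have "\<dots> = (\<Sum>x\<in>A. \<Sum>y\<in>A. (cnj (c x) * g x) * cnj (cnj (c y) * g y))"
        by (intro sum.cong refl) (simp only: kernel AX, simp add: mult_ac)
      also have "\<dots> = (\<Sum>x\<in>A. cnj (c x) * g x) * cnj (\<Sum>x\<in>A. cnj (c x) * g x)"
        by (simp add: sum_product)
      also have "\<dots> = of_real ((cmod (\<Sum>x\<in>A. cnj (c x) * g x))\<^sup>2)"
        by (simp only: complex_norm_square)
      finally have "(nrm (\<Sum>y\<in>A. cscale (c y) (K y)))\<^sup>2 - (\<Sum>j\<in>J. (nrm (u j))\<^sup>2)
          = (cmod (\<Sum>x\<in>A. cnj (c x) * g x))\<^sup>2"
        by (simp only: of_real_eq_iff)
      then have "(\<Sum>j\<in>J. (nrm (u j))\<^sup>2) \<le> (nrm (\<Sum>y\<in>A. cscale (c y) (K y)))\<^sup>2"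
        using zero_le_power2[of "cmod (\<Sum>x\<in>A. cnj (c x) * g x)"] by linarith
      then show ?thesis
        unfolding L2_set_def by (intro real_le_lsqrt) simp_all
    qed
    finally show ?thesis
      using \<open>s \<ge> 0\<close> by (simp add: mult.commute mult_right_mono)
  qed
  show "f \<in> H" "nrm f \<le> s"
    using mem_carrier_criterion[OF out \<open>s \<ge> 0\<close> bound] by blast+
qed

text \<open>The adjoint of the row operator maps \<open>K y\<close> to the column with entries
  \<open>cnj (F j y) K y\<close>; this tests its norm on the span of \<open>K p\<close> and \<open>K q\<close>.\<close>

lemma row_two_point:
  assumes J: "finite J" and r: "r \<ge> 0"
    and FH: "\<And>h. (\<And>j. j \<in> J \<Longrightarrow> h j \<in> H) \<Longrightarrow> (\<Sum>j\<in>J. F j * h j) \<in> H"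
    and Fr: "\<And>h. (\<And>j. j \<in> J \<Longrightarrow> h j \<in> H) \<Longrightarrow>
      nrm (\<Sum>j\<in>J. F j * h j) \<le> r * sqrt (\<Sum>j\<in>J. (nrm (h j))\<^sup>2)"
    and pq: "p \<in> X" "q \<in> X" "p \<noteq> q"
  defines "M \<equiv> \<lambda>x y. (of_real (r\<^sup>2) - (\<Sum>j\<in>J. F j x * cnj (F j y))) * k x y"
  shows "Re (M p p) \<ge> 0" "(cmod (M p q))\<^sup>2 \<le> Re (M p p) * Re (M q q)"
proof -
  \<comment> \<open>Positivity of \<open>r\<^sup>2\<close> times the identity minus row times
    adjoint, on finite combinations of kernel functions.\<close>
  have pos: "0 \<le> Re (\<Sum>x\<in>A. \<Sum>y\<in>A. cnj (c x) * c y * M x y)"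
    if A: "finite A" "A \<subseteq> X" for A c
  proof -
    define u where "u j = (\<Sum>y\<in>A. cscale (c y * cnj (F j y)) (K y))" for j
    define g where "g = (\<Sum>y\<in>A. cscale (c y) (K y))"
    define U where "U = (\<Sum>j\<in>J. (nrm (u j))\<^sup>2)"
    define f where "f = (\<Sum>j\<in>J. F j * u j)"
    have AX [simp]: "y \<in> A \<Longrightarrow> y \<in> X" for y using A by auto
    have uH [simp]: "u j \<in> H" for j by (simp add: u_def)
    have gH [simp]: "g \<in> H" by (simp add: g_def)
    have fH [simp]: "f \<in> H" unfolding f_def by (rule FH) simp
    have U0: "U \<ge> 0" by (simp add: U_def sum_nonneg)
    have fx: "f x = (\<Sum>j\<in>J. F j x * u j x)" for x
      unfolding f_def using J by (induction J) auto
    \<comment> \<open>\<open>u\<close> is the adjoint applied to \<open>g\<close>, and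
      \<open>f\<close> is the row applied to \<open>u\<close>. The squared norm \<open>U\<close> of
      \<open>u\<close> is therefore \<open>ip g f\<close>, checked here by point
      evaluations.\<close>
    have "ip g f = (\<Sum>y\<in>A. c y * cnj (f y))"
      by (simp add: g_def ip_sum_left reproducing_cnj)
    also have "\<dots> = (\<Sum>y\<in>A. \<Sum>j\<in>J. c y * cnj (F j y) * cnj (u j y))"
      by (simp add: fx sum_distrib_left mult.assoc)
    also have "\<dots> = (\<Sum>j\<in>J. \<Sum>y\<in>A. c y * cnj (F j y) * cnj (u j y))"
      by (rule sum.swap)
    also have "\<dots> = (\<Sum>j\<in>J. \<Sum>y\<in>A. ip (cscale (c y * cnj (F j y)) (K y)) (u j))"
      by (simp add: reproducing_cnj)
    also have "\<dots> = (\<Sum>j\<in>J. ip (u j) (u j))"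
      by (subst (2) u_def) (simp add: ip_sum_left)
    also have "\<dots> = of_real U"
      by (simp add: ip_self U_def)
    finally have "U = cmod (ip g f)" using U0 by simp
    also have "\<dots> \<le> nrm g * nrm f" by (rule cauchy_schwarz) simp_all
    also have "\<dots> \<le> nrm g * (r * sqrt U)"
      unfolding f_def U_def by (intro mult_left_mono Fr) simp_all
    finally have *: "sqrt U * sqrt U \<le> r * nrm g * sqrt U" using U0 by (simp add: mult_ac)
    have "sqrt U \<le> r * nrm g"
    proof (cases "U = 0")
      case False
      then have "sqrt U > 0" using U0 by simp
      with * show ?thesis by (simp only: mult_le_cancel_right_pos)
    qed (use r in simp)
    then have "U \<le> (r * nrm g)\<^sup>2"
      using U0 by (metis real_sqrt_ge_zero power_mono real_sqrt_pow2)
    then have "0 \<le> r\<^sup>2 * (nrm g)\<^sup>2 - U" by (simp add: power_mult_distrib)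
    moreover have "of_real (r\<^sup>2 * (nrm g)\<^sup>2 - U) = (\<Sum>x\<in>A. \<Sum>y\<in>A. cnj (c x) * c y * M x y)"
      unfolding of_real_diff of_real_mult g_def U_def u_def nrm_kernel_sum[OF A]
        sum_nrm_kernel_sums[OF A] sum_distrib_left sum_subtractf[symmetric] M_def
      by (simp add: algebra_simps)
    ultimately show ?thesis by (metis Re_complex_of_real)
  qed
  have kc: "k y x = cnj (k x y)" if "x \<in> X" "y \<in> X" for x y
    using ip_cnj[of "K y" "K x"] that by (simp add: ip_K_K)
  have Mc: "M y x = cnj (M x y)" if "x \<in> X" "y \<in> X" for x y
    unfolding M_def kc[OF that] by (simp add: mult.commute)
  have "0 \<le> Re (M p p) * (cmod s)\<^sup>2 + Re (M q q) * (cmod t)\<^sup>2 + 2 * Re (cnj s * t * M p q)" for s t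
  proof -
    have im: "Im (M p p) = 0" "Im (M q q) = 0"
      using Mc[of p p] Mc[of q q] pq by (simp_all add: complex_eq_iff)
    have "0 \<le> Re (cnj s * s * M p p + cnj s * t * M p q + (cnj t * s * M q p + cnj t * t * M q q))"
      using pos[of "{p, q}" "\<lambda>x. if x = p then s else t"] pq by simp
    also have "\<dots> = Re (M p p) * (cmod s)\<^sup>2 + Re (M q q) * (cmod t)\<^sup>2 + 2 * Re (cnj s * t * M p q)"
      unfolding Mc[OF pq(1,2)] cmod_power2 using im
      by (simp add: power2_eq_square algebra_simps)
    finally show ?thesis .
  qed
  then show "Re (M p p) \<ge> 0" "(cmod (M p q))\<^sup>2 \<le> Re (M p p) * Re (M q q)"
    using hermitian_form_2[of "Re (M p p)" "Re (M q q)" "M p q"] by blast+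
qed

end

section \<open>The space of a subset of the ball\<close>

lemma restr_in [simp]: "x \<in> X \<Longrightarrow> restr X f x = f x"
  and restr_out [simp]: "x \<notin> X \<Longrightarrow> restr X f x = 0"
  by (simp_all add: restr_def)

lemma restr_zero: "restr X 0 = 0"
  and restr_add: "restr X f + restr X g = restr X (f + g)"
  and restr_diff: "restr X f - restr X g = restr X (f - g)"
  and restr_scale: "cscale c (restr X f) = restr X (cscale c f)"
  by (auto simp: restr_def cscale_def fun_eq_iff)

lemma subset_ball_norm: "A \<subseteq> ball 0 1 \<Longrightarrow> x \<in> A \<Longrightarrow> norm x < 1"
  by auto

lemma drury_arveson_rkhs: "is_drury_arveson D \<Longrightarrow> rkhs (ball 0 1) da_kernel D"
  by (simp add: is_drury_arveson_def rkhs_def)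

context
  fixes D :: "(complex ^ 'd) fun_space" and V :: "(complex ^ 'd) set"
  assumes D: "is_drury_arveson D" and V: "V \<subseteq> ball 0 1"
begin

interpretation D: rkhs "ball 0 1" da_kernel D
  using D by (rule drury_arveson_rkhs)

section \<open>The closed span of the kernel functions at points of \<open>V\<close>\<close>

abbreviation "clspan \<equiv> kernel_closed_span D V"
abbreviation "kspan \<equiv> cfun.span (kernel_fun (ball 0 1) da_kernel ` V)"

lemma kspan_carrier: "kspan \<subseteq> fcarrier D"
  using V by (intro cfun.span_minimal[OF _ D.subspace_carrier]) (auto intro!: D.K_carrier)

lemma clspan_carrier: "f \<in> clspan \<Longrightarrow> f \<in> fcarrier D"
  by (simp add: kernel_closed_span_def)

lemma clspan_I:
  "f \<in> fcarrier D \<Longrightarrow> (\<And>e. e > 0 \<Longrightarrow> \<exists>g\<in>kspan. fnorm D (f - g) < e) \<Longrightarrow> f \<in> clspan"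
  by (simp add: kernel_closed_span_def)

lemma clspan_D: "f \<in> clspan \<Longrightarrow> e > 0 \<Longrightarrow> \<exists>g\<in>kspan. fnorm D (f - g) < e"
  by (simp add: kernel_closed_span_def)

lemma kernel_in_clspan: "y \<in> V \<Longrightarrow> kernel_fun (ball 0 1) da_kernel y \<in> clspan"
  using subset_ball_norm[OF V] by (intro clspan_I) (auto intro!: D.K_carrier bexI[OF _ cfun.span_base])

lemma clspan_closed:
  assumes f: "f \<in> fcarrier D" and close: "\<And>e. e > 0 \<Longrightarrow> \<exists>g\<in>clspan. fnorm D (f - g) < e"
  shows "f \<in> clspan"
proof (rule clspan_I[OF f])
  fix e :: real assume "e > 0"
  then obtain g where g: "g \<in> clspan" "fnorm D (f - g) < e / 2" using close[of "e / 2"] by auto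
  obtain h where h: "h \<in> kspan" "fnorm D (g - h) < e / 2" using clspan_D[OF g(1), of "e / 2"] \<open>e > 0\<close> by auto
  have "fnorm D (f - h) < e"
    using D.nrm_triangle_diff[OF f clspan_carrier[OF g(1)]] h kspan_carrier g(2) by fastforce
  with h(1) show "\<exists>g\<in>kspan. fnorm D (f - g) < e" by blast
qed

lemma clspan_subspace: "cfun.subspace clspan"
  unfolding cfun.subspace_def
proof (intro conjI ballI allI)
  show "0 \<in> clspan" by (rule clspan_I) (auto intro!: bexI[OF _ cfun.span_zero])
next
  fix f f' assume f: "f \<in> clspan" and f': "f' \<in> clspan"
  show "f + f' \<in> clspan"
  proof (rule clspan_I)
    fix e :: real assume "e > 0"
    then obtain g g' where g: "g \<in> kspan" "g' \<in> kspan"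
      "fnorm D (f - g) < e / 2" "fnorm D (f' - g') < e / 2"
      using clspan_D[OF f, of "e / 2"] clspan_D[OF f', of "e / 2"] by auto
    have "fnorm D ((f - g) + (f' - g')) \<le> fnorm D (f - g) + fnorm D (f' - g')"
      using f f' g kspan_carrier clspan_carrier by (intro D.nrm_triangle D.carrier_diff) auto
    then have "fnorm D (f + f' - (g + g')) < e" using g by (simp add: algebra_simps)
    then show "\<exists>g\<in>kspan. fnorm D (f + f' - g) < e" using cfun.span_add[OF g(1,2)] by blast
  qed (use f f' clspan_carrier in simp)
next
  fix c f assume f: "f \<in> clspan"
  show "cscale c f \<in> clspan"
  proof (rule clspan_I)
    fix e :: real assume "e > 0"
    \<comment> \<open>Dividing by \<open>cmod c + 1\<close> instead of \<open>cmod c\<close> covers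
      \<open>c = 0\<close>.\<close>
    then obtain g where g: "g \<in> kspan" "fnorm D (f - g) < e / (cmod c + 1)"
      using clspan_D[OF f, of "e / (cmod c + 1)"] by (auto simp: add_nonneg_pos)
    have fg: "f - g \<in> fcarrier D" using f g clspan_carrier kspan_carrier by auto
    have "fnorm D (cscale c f - cscale c g) = cmod c * fnorm D (f - g)"
      using D.nrm_scale[OF fg] by (simp add: cfun.scale_right_diff_distrib)
    also have "\<dots> \<le> (cmod c + 1) * fnorm D (f - g)"
      using D.nrm_nonneg[OF fg] by (simp add: distrib_right)
    also have "\<dots> < e" using g(2) by (simp add: pos_less_divide_eq add_nonneg_pos mult.commute)
    finally show "\<exists>g\<in>kspan. fnorm D (cscale c f - g) < e" using cfun.span_scale[OF g(1)] by blast
  qed (use f clspan_carrier in simp)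
qed

lemma inj_on_restr: "inj_on (restr V) clspan"
proof (rule inj_onI)
  fix f f' assume f: "f \<in> clspan" "f' \<in> clspan" and eq: "restr V f = restr V f'"
  define m where "m = f - f'"
  have m: "m \<in> clspan" unfolding m_def by (rule cfun.subspace_diff[OF clspan_subspace f])
  have mD: "m \<in> fcarrier D" using clspan_carrier m .
  have "m y = 0" if "y \<in> V" for y
    using fun_cong[OF eq, of y] that by (simp add: m_def)
  then have "kernel_fun (ball 0 1) da_kernel ` V \<subseteq> {g \<in> fcarrier D. finner D g m = 0}"
    using mD V by (auto simp: D.reproducing_cnj intro!: D.K_carrier)
  moreover have "cfun.subspace {g \<in> fcarrier D. finner D g m = 0}"
    unfolding cfun.subspace_def using mD by auto
  ultimately have "finner D g m = 0" if "g \<in> kspan" for g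
    using cfun.span_minimal that by blast
  then have orth: "finner D m g = 0" if "g \<in> kspan" for g
    using that D.ip_cnj[of g m] kspan_carrier mD by auto
  \<comment> \<open>Since \<open>m\<close> is orthogonal to an approximant \<open>g\<close>, its
    squared norm equals \<open>finner D m (m - g)\<close>, which is at most
    \<open>fnorm D m * e\<close>.\<close>
  have small: "fnorm D m \<le> e" if "e > 0" for e
  proof -
    obtain g where g: "g \<in> kspan" "fnorm D (m - g) < e" using clspan_D[OF m \<open>e > 0\<close>] by blast
    have gD: "g \<in> fcarrier D" using kspan_carrier g by auto
    have "(fnorm D m)\<^sup>2 = cmod (finner D m (m - g))"
      using orth[OF g(1)] mD gD by (simp add: D.ip_self norm_power)
    also have "\<dots> \<le> fnorm D m * fnorm D (m - g)"
      using mD gD by (intro D.cauchy_schwarz) auto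
    also have "\<dots> \<le> fnorm D m * e" using g mD by (intro mult_left_mono) auto
    finally have "fnorm D m * fnorm D m \<le> fnorm D m * e" by (simp add: power2_eq_square)
    then show ?thesis
      using D.nrm_nonneg[OF mD] \<open>e > 0\<close> by (cases "fnorm D m = 0") auto
  qed
  have "fnorm D m \<le> 0" by (rule field_le_epsilon) (use small in simp)
  then have "m = 0" using D.nrm_nonneg[OF mD] D.nrm_eq_0[OF mD] by linarith
  then show "f = f'" by (simp add: m_def)
qed

section \<open>Transport of the Hilbert space structure to functions on \<open>V\<close>\<close>

lemma HV_carrier: "fcarrier (HV D V) = restr V ` clspan"
  by (simp add: HV_def)

lemma HV_inner:
  "m \<in> clspan \<Longrightarrow> m' \<in> clspan \<Longrightarrow> finner (HV D V) (restr V m) (restr V m') = finner D m m'"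
  by (simp add: HV_def inv_into_f_f[OF inj_on_restr])

lemma HV_norm: "m \<in> clspan \<Longrightarrow> fnorm (HV D V) (restr V m) = fnorm D m"
  by (simp add: fnorm_def HV_inner)

lemmas clspan_closure = cfun.subspace_add[OF clspan_subspace] cfun.subspace_diff[OF clspan_subspace]
  cfun.subspace_scale[OF clspan_subspace] cfun.subspace_0[OF clspan_subspace]

text \<open>Restriction is isometric on \<open>clspan\<close>, so a Cauchy sequence lifts to
  \<open>D\<close>; its limit there stays in the closed span.\<close>

lemma HV_complete:
  assumes s: "\<And>n :: nat. s n \<in> fcarrier (HV D V)"
    and cauchy: "\<And>e. e > 0 \<Longrightarrow> \<exists>N. \<forall>m\<ge>N. \<forall>n\<ge>N. fnorm (HV D V) (s m - s n) < e"
  shows "\<exists>f\<in>fcarrier (HV D V). (\<lambda>n. fnorm (HV D V) (s n - f)) \<longlonglongrightarrow> 0"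
proof -
  have "\<forall>n. \<exists>m\<in>clspan. s n = restr V m" using s by (auto simp: HV_carrier)
  then obtain m where m: "\<And>n. m n \<in> clspan" "\<And>n. s n = restr V (m n)" by metis
  have dist: "fnorm (HV D V) (s i - s j) = fnorm D (m i - m j)" for i j
    by (simp add: m restr_diff HV_norm clspan_closure)
  obtain h where h: "h \<in> fcarrier D" "(\<lambda>n. fnorm D (m n - h)) \<longlonglongrightarrow> 0"
    by (rule D.complete[of m, OF clspan_carrier[OF m(1)] cauchy[unfolded dist]])
  have hM: "h \<in> clspan"
  proof (rule clspan_closed[OF h(1)])
    fix e :: real assume "e > 0"
    with order_tendstoD(2)[OF h(2)] have "\<forall>\<^sub>F n in sequentially. fnorm D (m n - h) < e" .
    then obtain n where "fnorm D (m n - h) < e" using eventually_happens'[OF sequentially_bot] by blast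
    then have "fnorm D (h - m n) < e"
      by (simp only: D.nrm_minus_commute[OF h(1) clspan_carrier[OF m(1)]])
    then show "\<exists>g\<in>clspan. fnorm D (h - g) < e" using m(1) by (rule bexI)
  qed
  have "fnorm (HV D V) (s n - restr V h) = fnorm D (m n - h)" for n
    by (simp add: m restr_diff HV_norm clspan_closure hM)
  with h(2) have "(\<lambda>n. fnorm (HV D V) (s n - restr V h)) \<longlonglongrightarrow> 0" by simp
  moreover have "restr V h \<in> fcarrier (HV D V)" using hM by (simp add: HV_carrier)
  ultimately show ?thesis by (rule bexI)
qed

text \<open>The kernel function at a point of \<open>V\<close> restricts from the ball. This makes
  the multiplier results above available on any subset of the ball.\<close>

lemma HV_rkhs: "rkhs V da_kernel (HV D V)"
proof -
  have "is_fun_hilbert_space V (HV D V)"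
    unfolding is_fun_hilbert_space_def
  proof (intro conjI)
    show "cfun.subspace (fcarrier (HV D V))"
      unfolding cfun.subspace_def HV_carrier
      using clspan_closure by (auto simp: restr_add restr_scale intro!: image_eqI[of 0 _ 0] simp: restr_zero)
    show "\<forall>f\<in>fcarrier (HV D V). \<forall>g\<in>fcarrier (HV D V). finner (HV D V) g f = cnj (finner (HV D V) f g)"
      by (auto simp: HV_carrier HV_inner intro: D.ip_cnj clspan_carrier)
    show "\<forall>f\<in>fcarrier (HV D V). f \<noteq> 0 \<longrightarrow> 0 < Re (finner (HV D V) f f)"
    proof (intro ballI impI)
      fix f assume "f \<in> fcarrier (HV D V)" "f \<noteq> 0"
      then obtain m where m: "m \<in> clspan" "f = restr V m" by (auto simp: HV_carrier)
      with \<open>f \<noteq> 0\<close> have "m \<noteq> 0" by (auto simp: restr_zero)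
      with m show "0 < Re (finner (HV D V) f f)" by (simp add: HV_inner D.ip_pos clspan_carrier)
    qed
  qed (use HV_complete in \<open>auto simp: HV_carrier HV_inner restr_add restr_scale clspan_closure clspan_carrier\<close>)
  moreover have "kernel_fun V da_kernel y = restr V (kernel_fun (ball 0 1) da_kernel y)" for y
    using V by (auto simp: kernel_fun_def restr_def fun_eq_iff)
  ultimately show ?thesis
    by unfold_locales
      (auto simp: is_rkhs_def HV_carrier HV_inner kernel_in_clspan D.reproducing clspan_carrier subset_ball_norm[OF V])
qed

end

section \<open>Pseudohyperbolic geometry of the ball\<close>

lemma cinner_diff_left: "cinner (x - y) z = cinner x z - cinner y z"
  and cinner_diff_right: "cinner x (y - z) = cinner x y - cinner x z"
  and cinner_scale_left: "cinner (c *s x) y = c * cinner x y"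
  and cinner_scale_right: "cinner x (c *s y) = cnj c * cinner x y"
  and cinner_commute: "cinner x y = cnj (cinner y x)"
  by (simp_all add: cinner_def algebra_simps sum.distrib sum_subtractf sum_distrib_left)

lemma cinner_self: "cinner x x = of_real ((norm x)\<^sup>2)"
  by (simp add: cinner_def norm_vec_def L2_set_def sum_nonneg complex_norm_square[symmetric])

lemma cinner_cauchy_schwarz: "cmod (cinner x y) \<le> norm x * norm y"
proof -
  have "cmod (cinner x y) \<le> (\<Sum>i\<in>UNIV. \<bar>norm (x $ i)\<bar> * \<bar>norm (y $ i)\<bar>)"
    unfolding cinner_def by (rule sum_norm_le) (simp add: norm_mult)
  also have "\<dots> \<le> norm x * norm y"
    unfolding norm_vec_def by (rule L2_set_mult_ineq)
  finally show ?thesis .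
qed

lemma cinner_ne_1:
  assumes "norm x < 1" "norm y < 1"
  shows "cinner x y \<noteq> 1"
proof -
  have "norm x * norm y < 1" using mult_strict_mono[of "norm x" 1 "norm y" 1] assms by simp
  then show ?thesis using cinner_cauchy_schwarz[of x y] by auto
qed

text \<open>The square of the pseudohyperbolic distance of the ball.\<close>

definition phd_sq :: "complex ^ 'd \<Rightarrow> complex ^ 'd \<Rightarrow> real" where
  "phd_sq x y = 1 - (1 - (norm x)\<^sup>2) * (1 - (norm y)\<^sup>2) / (cmod (1 - cinner x y))\<^sup>2"

lemma phd_sq_less_1: "norm x < 1 \<Longrightarrow> norm y < 1 \<Longrightarrow> phd_sq x y < 1"
  using cinner_ne_1[of x y] by (simp add: phd_sq_def abs_square_less_1)

lemma norm_diff_power2: "(norm (x - y))\<^sup>2 = (norm x)\<^sup>2 + (norm y)\<^sup>2 - 2 * Re (cinner x y)"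
proof -
  have "of_real ((norm (x - y))\<^sup>2) = of_real ((norm x)\<^sup>2 + (norm y)\<^sup>2) - (cinner x y + cnj (cinner x y))"
    unfolding cinner_self[symmetric] of_real_add cinner_diff_left cinner_diff_right
      cinner_commute[of y x, symmetric] by simp
  also have "cinner x y + cnj (cinner x y) = of_real (2 * Re (cinner x y))"
    by (simp add: complex_add_cnj)
  finally show ?thesis by (metis of_real_diff of_real_eq_iff)
qed

text \<open>The Gram determinant of the pair. It vanishes in dimension one and measures how the ball
  departs from the disc in the identities below.\<close>

definition gram :: "complex ^ 'd \<Rightarrow> complex ^ 'd \<Rightarrow> real" where
  "gram x y = (norm x)\<^sup>2 * (norm y)\<^sup>2 - (cmod (cinner x y))\<^sup>2"

text \<open>A Gram determinant is unchanged when one vector is subtracted from the other.\<close>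

lemma gram_diff: "gram (x - y) y = gram x y"
  unfolding gram_def cinner_diff_left norm_diff_power2 cinner_self cmod_power2
  by (simp add: power2_eq_square algebra_simps)

lemma gram_le: "gram x y \<le> (norm (x - y))\<^sup>2 * (norm y)\<^sup>2"
  unfolding gram_diff[symmetric, of x y] by (simp add: gram_def)

text \<open>The left side is the numerator of \<open>phd_sq x y\<close>. The right side shows how it
  scales under a common dilation of both points.\<close>

lemma cmod_1_cinner_power2:
  "(cmod (1 - cinner x y))\<^sup>2 - (1 - (norm x)\<^sup>2) * (1 - (norm y)\<^sup>2) = (norm (x - y))\<^sup>2 - gram x y"
  unfolding gram_def norm_diff_power2 cmod_power2
  by (simp add: power2_eq_square algebra_simps)

text \<open>For distinct points of the open ball, \<open>gram x y\<close> is at most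
  \<open>(norm (x - y))\<^sup>2 * (norm y)\<^sup>2\<close>, which is strictly below
  \<open>(norm (x - y))\<^sup>2\<close>.\<close>

lemma phd_sq_pos:
  assumes "norm x < 1" "norm y < 1" "x \<noteq> y"
  shows "phd_sq x y > 0"
proof -
  have "(norm (x - y))\<^sup>2 * (norm y)\<^sup>2 < (norm (x - y))\<^sup>2 * 1"
    using assms by (intro mult_strict_left_mono) (auto simp: abs_square_less_1)
  then have "(1 - (norm x)\<^sup>2) * (1 - (norm y)\<^sup>2) < (cmod (1 - cinner x y))\<^sup>2"
    using cmod_1_cinner_power2[of x y] gram_le[of x y] by linarith
  then show ?thesis using cinner_ne_1[OF assms(1,2)] by (simp add: phd_sq_def)
qed

text \<open>In terms of \<open>t = phd_sq / (1 - phd_sq)\<close> this reads \<open>t (c p) (c q) \<le> c\<^sup>2 t p q\<close>.\<close>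

lemma dilation_contracts:
  fixes c :: real
  assumes c: "0 \<le> c" "c \<le> 1" and pq: "norm p \<le> 1" "norm q \<le> 1"
  defines "N \<equiv> \<lambda>x y. (cmod (1 - cinner x y))\<^sup>2 - (1 - (norm x)\<^sup>2) * (1 - (norm y)\<^sup>2)"
    and "m \<equiv> \<lambda>x y :: complex ^ 'd. (1 - (norm x)\<^sup>2) * (1 - (norm y)\<^sup>2)"
  shows "N (c *\<^sub>R p) (c *\<^sub>R q) * m p q \<le> c\<^sup>2 * (N p q * m (c *\<^sub>R p) (c *\<^sub>R q))"
proof -
  define d g x y where "d = (norm (p - q))\<^sup>2" and "g = gram p q"
    and "x = (norm p)\<^sup>2" and "y = (norm q)\<^sup>2"
  have c2: "c\<^sup>2 \<le> 1" using c by (simp add: power_le_one)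
  have xy: "0 \<le> x" "x \<le> 1" "0 \<le> y" "y \<le> 1" using pq by (auto simp: x_def y_def power_le_one)
  have cx: "c\<^sup>2 * x \<le> x" "c\<^sup>2 * x \<le> 1" "c\<^sup>2 * y \<le> 1"
    using c2 xy by (auto simp: mult_left_le_one_le mult_le_one)
  have gy: "g \<le> d * y" unfolding d_def g_def y_def by (rule gram_le)
  also have "d * y \<le> d" using xy by (simp add: d_def mult_left_le)
  finally have gd: "g \<le> d" .
  \<comment> \<open>Under dilation the numerator \<open>d - g\<close> becomes
    \<open>c\<^sup>2 * (d - c\<^sup>2 * g)\<close>. The product shown is exactly the difference of
    the two sides of the next inequality.\<close>
  have "0 \<le> (1 - c\<^sup>2) * (d * y - g)" using c2 gy by simp
  then have 1: "(d - c\<^sup>2 * g) * (1 - y) \<le> (d - g) * (1 - c\<^sup>2 * y)" by (simp add: algebra_simps)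
  have "(d - c\<^sup>2 * g) * (1 - y) * (1 - x) \<le> (d - g) * (1 - c\<^sup>2 * y) * (1 - x)"
    using 1 xy by (intro mult_right_mono) auto
  also have "\<dots> \<le> (d - g) * (1 - c\<^sup>2 * y) * (1 - c\<^sup>2 * x)"
    using cx gd by (intro mult_left_mono) auto
  finally have "c\<^sup>2 * ((d - c\<^sup>2 * g) * (1 - y) * (1 - x)) \<le> c\<^sup>2 * ((d - g) * (1 - c\<^sup>2 * y) * (1 - c\<^sup>2 * x))"
    by (intro mult_left_mono) auto
  moreover have "gram (c *\<^sub>R p) (c *\<^sub>R q) = c\<^sup>2 * c\<^sup>2 * g"
  proof -
    have "c *\<^sub>R p = of_real c *s p" "c *\<^sub>R q = of_real c *s q"
      by (simp_all add: vec_eq_iff scaleR_conv_of_real[where 'a = complex])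
    then have "cinner (c *\<^sub>R p) (c *\<^sub>R q) = of_real (c\<^sup>2) * cinner p q"
      by (simp add: cinner_scale_left cinner_scale_right power2_eq_square)
    then show ?thesis
      by (simp add: g_def gram_def norm_mult power_mult_distrib norm_power power2_eq_square algebra_simps)
  qed
  moreover have "(norm (c *\<^sub>R p - c *\<^sub>R q))\<^sup>2 = c\<^sup>2 * d"
    by (simp add: d_def scaleR_diff_right[symmetric] power_mult_distrib)
  ultimately show ?thesis
    unfolding N_def m_def cmod_1_cinner_power2
    by (simp add: d_def[symmetric] g_def[symmetric] x_def[symmetric] y_def[symmetric] power_mult_distrib)
      (simp add: algebra_simps)
qed

text \<open>The involutive automorphism of the ball interchanging \<open>0\<close> and \<open>a\<close>. With
  \<open>s = sqrt (1 - (norm a)\<^sup>2)\<close> one has \<open>(1 - s) / (norm a)\<^sup>2 = 1 / (1 + s)\<close>, which avoids the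
  usual exceptional case \<open>a = 0\<close>.\<close>

definition ball_aut :: "complex ^ 'd \<Rightarrow> complex ^ 'd \<Rightarrow> complex ^ 'd" where
  "ball_aut a z = (let s = complex_of_real (sqrt (1 - (norm a)\<^sup>2)) in
     (1 / (1 - cinner z a)) *s ((1 - cinner z a / (1 + s)) *s a - s *s z))"

text \<open>The classical transformation rule of the kernel under a ball automorphism. Its rank one
  right side is the hypothesis under which a row is contractive.\<close>

lemma ball_aut_kernel:
  assumes "norm a < 1" "norm z < 1" "norm w < 1"
  defines "s \<equiv> complex_of_real (sqrt (1 - (norm a)\<^sup>2))"
  shows "(1 - cinner (ball_aut a z) (ball_aut a w)) * da_kernel z w
    = (s / (1 - cinner z a)) * cnj (s / (1 - cinner w a))"
proof -
  \<comment> \<open>\<open>\<beta>\<close> has \<open>a\<close> in the first slot, so that the inner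
    product of the two images contains no conjugates.\<close>
  define \<alpha> \<beta> \<gamma> where "\<alpha> = cinner z a" and "\<beta> = cinner a w" and "\<gamma> = cinner z w"
  have a1: "(norm a)\<^sup>2 \<le> 1" using assms by (simp add: power_le_one)
  then have s2: "s * s = 1 - of_real ((norm a)\<^sup>2)"
    unfolding s_def by (simp add: of_real_mult[symmetric] del: of_real_mult)
  have cs: "cnj s = s" by (simp add: s_def)
  have s1: "1 + s \<noteq> 0"
  proof -
    have "1 + sqrt (1 - (norm a)\<^sup>2) > 0" using a1 by (intro add_pos_nonneg) auto
    then show ?thesis by (auto simp: s_def complex_eq_iff)
  qed
  have cb: "cinner w a = cnj \<beta>" by (simp add: \<beta>_def cinner_commute[of w a])
  have ne: "1 - \<alpha> \<noteq> 0" "1 - \<beta> \<noteq> 0" "1 - \<gamma> \<noteq> 0"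
    using cinner_ne_1 assms by (auto simp: \<alpha>_def \<beta>_def \<gamma>_def)
  define u v where "u = 1 - \<alpha> / (1 + s)" and "v = 1 - \<beta> / (1 + s)"
  have u: "(1 + s) * u = 1 + s - \<alpha>" and v: "(1 + s) * v = 1 + s - \<beta>"
    using s1 by (simp_all add: u_def v_def field_simps)
  have "cinner (u *s a - s *s z) (cnj v *s a - s *s w)
      = u * v * cinner a a - s * u * \<beta> - s * v * \<alpha> + s * s * \<gamma>"
    unfolding cinner_diff_left cinner_diff_right cinner_scale_left cinner_scale_right
      \<alpha>_def \<beta>_def \<gamma>_def complex_cnj_cnj cs by (simp add: algebra_simps)
  also have "cinner a a = 1 - s * s" by (simp add: cinner_self s2)
  finally have E0: "cinner (u *s a - s *s z) (cnj v *s a - s *s w)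
      = u * v * (1 - s * s) - s * u * \<beta> - s * v * \<alpha> + s * s * \<gamma>" .
  have "ball_aut a z = (1 / (1 - \<alpha>)) *s (u *s a - s *s z)"
    "ball_aut a w = (1 / (1 - cnj \<beta>)) *s (cnj v *s a - s *s w)"
    by (simp_all add: ball_aut_def Let_def s_def[symmetric] \<alpha>_def u_def v_def cb cs)
  then have E1: "cinner (ball_aut a z) (ball_aut a w)
      = (u * v * (1 - s * s) - s * u * \<beta> - s * v * \<alpha> + s * s * \<gamma>) / ((1 - \<alpha>) * (1 - \<beta>))"
    by (simp only: cinner_scale_left cinner_scale_right E0 complex_cnj_divide complex_cnj_diff
        complex_cnj_cnj complex_cnj_one times_divide_times_eq times_divide_eq_left mult_1 divide_divide_eq_left mult.commute)
  \<comment> \<open>Multiplication by \<open>1 + s\<close> clears the denominators of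
    \<open>u\<close> and \<open>v\<close>.\<close>
  have E2: "u * v * (1 - s * s) - s * u * \<beta> - s * v * \<alpha>
      = (1 - \<alpha>) * (1 - \<beta>) - s * s"
  proof -
    have "(1 + s) * (u * v * (1 - s * s) - s * u * \<beta> - s * v * \<alpha>)
        = ((1 + s) * u) * ((1 + s) * v) * (1 - s) - s * ((1 + s) * u) * \<beta> - s * ((1 + s) * v) * \<alpha>"
      by (simp add: algebra_simps)
    also have "\<dots> = (1 + s) * ((1 - \<alpha>) * (1 - \<beta>) - s * s)"
      unfolding u v by (simp add: algebra_simps)
    finally show ?thesis by (simp only: mult_left_cancel[OF s1])
  qed
  have E3: "1 - (d - s * s + s * s * \<gamma>) / d = s * s * (1 - \<gamma>) / d" if "d \<noteq> 0" for d
    using that by (simp add: field_simps)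
  have "(1 - \<alpha>) * (1 - \<beta>) \<noteq> 0" using ne by simp
  from E3[OF this] have E4: "1 - cinner (ball_aut a z) (ball_aut a w) = s * s * (1 - \<gamma>) / ((1 - \<alpha>) * (1 - \<beta>))"
    unfolding E1 E2 .
  have E5: "s * s * g / (x * y) * (1 / g) = s / x * (s / y)" if "g \<noteq> 0" for g x y
    using that by simp
  show ?thesis
    unfolding E4 da_kernel_def cb \<alpha>_def[symmetric] \<gamma>_def[symmetric] E5[OF ne(3)]
    by (simp add: cs)
qed

lemma ball_aut_self:
  assumes "norm a < 1"
  shows "ball_aut a a = 0"
proof -
  define s where "s = complex_of_real (sqrt (1 - (norm a)\<^sup>2))"
  have a1: "(norm a)\<^sup>2 \<le> 1" using assms by (simp add: power_le_one)
  then have s2: "of_real ((norm a)\<^sup>2) = (1 - s) * (1 + s)"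
    unfolding s_def by (simp add: of_real_mult[symmetric] algebra_simps del: of_real_mult)
  have s1: "1 + s \<noteq> 0"
  proof -
    have "1 + sqrt (1 - (norm a)\<^sup>2) > 0" using a1 by (intro add_pos_nonneg) auto
    then show ?thesis by (auto simp: s_def complex_eq_iff)
  qed
  have "1 - cinner a a / (1 + s) = s" unfolding cinner_self s2 using s1 by simp
  then show ?thesis unfolding ball_aut_def Let_def s_def[symmetric] by simp
qed

text \<open>The kernel identity on the diagonal. Through it, evaluating the automorphism row at a
  point yields the pseudohyperbolic distance.\<close>

lemma norm_ball_aut:
  assumes "norm a < 1" "norm z < 1"
  shows "(norm (ball_aut a z))\<^sup>2 = phd_sq z a"
proof -
  define s where "s = complex_of_real (sqrt (1 - (norm a)\<^sup>2))"
  have a1: "(norm a)\<^sup>2 \<le> 1" using assms by (simp add: power_le_one)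
  have z1: "1 - (norm z)\<^sup>2 \<noteq> 0" using assms using abs_square_less_1[of "norm z"] by simp
  have "complex_of_real ((1 - (norm (ball_aut a z))\<^sup>2) / (1 - (norm z)\<^sup>2))
      = (s / (1 - cinner z a)) * cnj (s / (1 - cinner z a))"
    using ball_aut_kernel[OF assms(1,2,2)] unfolding s_def[symmetric]
    by (simp add: da_kernel_def cinner_self)
  also have "\<dots> = of_real ((1 - (norm a)\<^sup>2) / (cmod (1 - cinner z a))\<^sup>2)"
    using a1 unfolding complex_norm_square[symmetric]
    by (simp add: norm_divide power_divide s_def)
  finally have "(1 - (norm (ball_aut a z))\<^sup>2) / (1 - (norm z)\<^sup>2) = (1 - (norm a)\<^sup>2) / (cmod (1 - cinner z a))\<^sup>2"
    unfolding of_real_eq_iff .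
  then have "1 - (norm (ball_aut a z))\<^sup>2 = (1 - (norm a)\<^sup>2) / (cmod (1 - cinner z a))\<^sup>2 * (1 - (norm z)\<^sup>2)"
    unfolding nonzero_divide_eq_eq[OF z1] .
  then show ?thesis by (simp add: phd_sq_def mult.commute)
qed

section \<open>Row multipliers on subsets of the ball\<close>

context
  fixes D :: "(complex ^ 'd) fun_space" and V :: "(complex ^ 'd) set"
  assumes D: "is_drury_arveson D" and V: "V \<subseteq> ball 0 1"
begin

interpretation HV: rkhs V da_kernel "HV D V"
  using D V by (rule HV_rkhs)

abbreviation row_norm :: "('d \<Rightarrow> complex ^ 'd \<Rightarrow> complex) \<Rightarrow> ennreal" where
  "row_norm F \<equiv> op_norm (HV D V) (UNIV :: unit set) UNIV (\<lambda>_. F)"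

lemma zero_in_mult_alg: "0 \<in> mult_alg D V"
  by (simp add: mult_alg_def)

lemma mult_alg_row:
  assumes "\<And>j. F j \<in> mult_alg D V" "\<And>j. j \<in> J \<Longrightarrow> h j \<in> fcarrier (HV D V)"
  shows "(\<Sum>j\<in>J. F j * h j) \<in> fcarrier (HV D V)"
  using assms by (intro HV.carrier_sum) (simp add: mult_alg_def)

text \<open>Common source of the two test rows, the coordinates and the ball automorphisms.\<close>

lemma contractive_row:
  fixes \<Phi> :: "complex ^ 'd \<Rightarrow> complex ^ 'd"
  assumes kernel: "\<And>z w. z \<in> V \<Longrightarrow> w \<in> V \<Longrightarrow>
      (1 - cinner (\<Phi> z) (\<Phi> w)) * da_kernel z w = g z * cnj (g w)"
  defines "F \<equiv> \<lambda>j. restr V (\<lambda>z. \<Phi> z $ j)"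
  shows "F j \<in> mult_alg D V" "row_norm F \<le> 1"
proof -
  have k: "(1 - (\<Sum>j\<in>UNIV. F j z * cnj (F j w))) * da_kernel z w = g z * cnj (g w)"
    if "z \<in> V" "w \<in> V" for z w
    using kernel[OF that] that by (simp add: F_def cinner_def)
  have "F j * f \<in> fcarrier (HV D V)" if "f \<in> fcarrier (HV D V)" for f
  proof -
    \<comment> \<open>A column with the single entry \<open>f\<close> in position \<open>j\<close>
      isolates \<open>F j\<close>.\<close>
    have "(\<Sum>i\<in>UNIV. F i * (if i = j then f else 0)) \<in> fcarrier (HV D V)"
      by (rule HV.row_contraction(1)[OF k]) (use that in auto)
    also have "(\<Sum>i\<in>UNIV. F i * (if i = j then f else 0)) = (\<Sum>i\<in>UNIV. if i = j then F j * f else 0)"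
      by (rule sum.cong) auto
    finally show ?thesis by (simp only: sum.delta finite UNIV_I if_True)
  qed
  then show "F j \<in> mult_alg D V" by (simp add: mult_alg_def F_def)
  have "row_norm F \<le> ennreal 1"
    by (rule HV.op_norm_row_leI) (use HV.row_contraction[OF k] in auto)
  then show "row_norm F \<le> 1" by simp
qed

text \<open>With the identity as \<open>\<Phi>\<close> and \<open>g = 1\<close>, the kernel
  hypothesis is the definition of \<open>da_kernel\<close>.\<close>

lemma coordinate_row:
  "restr V (\<lambda>z. z $ j) \<in> mult_alg D V" "row_norm (\<lambda>j. restr V (\<lambda>z. z $ j)) \<le> 1"
proof -
  have "(1 - cinner z w) * da_kernel z w = 1 * cnj 1" if "z \<in> V" "w \<in> V" for z w
    using cinner_ne_1[OF subset_ball_norm[OF V] subset_ball_norm[OF V], OF that] by (simp add: da_kernel_def)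
  then show "restr V (\<lambda>z. z $ j) \<in> mult_alg D V" "row_norm (\<lambda>j. restr V (\<lambda>z. z $ j)) \<le> 1"
    using contractive_row[of "\<lambda>z. z" "\<lambda>_. 1"] by blast+
qed

lemma ball_aut_row:
  assumes "norm a < 1"
  shows "restr V (\<lambda>z. ball_aut a z $ j) \<in> mult_alg D V"
    "row_norm (\<lambda>j. restr V (\<lambda>z. ball_aut a z $ j)) \<le> 1"
  using contractive_row[OF ball_aut_kernel[OF assms]] V by (auto simp: subset_iff)

text \<open>The Pick matrix of the values at \<open>p\<close> and \<open>q\<close> is positive
  semidefinite. Its diagonal gives the norm bound, its determinant the inequality, written without
  denominators.\<close>

lemma mult_row_two_point:
  assumes F: "\<And>j. F j \<in> mult_alg D V" and r: "r > 0" and le: "row_norm F \<le> ennreal r"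
    and pq: "p \<in> V" "q \<in> V" "p \<noteq> q"
  defines "P \<equiv> (\<chi> j. F j p) :: complex ^ 'd" and "Q \<equiv> (\<chi> j. F j q) :: complex ^ 'd"
  shows "norm P \<le> r"
    "(cmod (of_real (r\<^sup>2) - cinner P Q))\<^sup>2 * ((1 - (norm p)\<^sup>2) * (1 - (norm q)\<^sup>2))
      \<le> (r\<^sup>2 - (norm P)\<^sup>2) * (r\<^sup>2 - (norm Q)\<^sup>2) * (cmod (1 - cinner p q))\<^sup>2"
proof -
  have n: "norm p < 1" "norm q < 1" using pq subset_ball_norm[OF V] by auto
  then have n2: "1 - (norm p)\<^sup>2 > 0" "1 - (norm q)\<^sup>2 > 0" by (simp_all add: abs_square_less_1)
  have ne: "cmod (1 - cinner p q) > 0" using cinner_ne_1[OF n] by simp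
  have s: "(\<Sum>j\<in>UNIV. F j x * cnj (F j y)) = cinner (\<chi> j. F j x) (\<chi> j. F j y)" for x y
    by (simp add: cinner_def)
  have Fr: "fnorm (HV D V) (\<Sum>j\<in>UNIV. F j * h j) \<le> r * sqrt (\<Sum>j\<in>UNIV. (fnorm (HV D V) (h j))\<^sup>2)"
    if "\<And>j. j \<in> UNIV \<Longrightarrow> h j \<in> fcarrier (HV D V)" for h
    using r that by (intro HV.op_norm_row_leD[OF le] mult_alg_row F) auto
  have diag: "Re ((of_real (r\<^sup>2) - cinner R R) * da_kernel x x) = (r\<^sup>2 - (norm R)\<^sup>2) / (1 - (norm x)\<^sup>2)"
    for R x :: "complex ^ 'd"
  proof -
    have "(of_real (r\<^sup>2) - cinner R R) * da_kernel x x = of_real ((r\<^sup>2 - (norm R)\<^sup>2) / (1 - (norm x)\<^sup>2))"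
      by (simp add: cinner_self da_kernel_def)
    then show ?thesis by (metis Re_complex_of_real)
  qed
  note * = HV.row_two_point[OF finite less_imp_le[OF r] mult_alg_row[OF F] Fr pq,
      unfolded s P_def[symmetric] Q_def[symmetric] diag]
  have "0 \<le> r\<^sup>2 - (norm P)\<^sup>2"
    using *(1) n2 by (simp add: zero_le_divide_iff)
  then show "norm P \<le> r"
    using r by (intro power2_le_imp_le[of "norm P" r]) auto
  have "(cmod (of_real (r\<^sup>2) - cinner P Q))\<^sup>2 / (cmod (1 - cinner p q))\<^sup>2
      \<le> (r\<^sup>2 - (norm P)\<^sup>2) * (r\<^sup>2 - (norm Q)\<^sup>2) / ((1 - (norm p)\<^sup>2) * (1 - (norm q)\<^sup>2))"
    using *(2) by (simp add: da_kernel_def norm_mult norm_divide power_divide)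
  then show "(cmod (of_real (r\<^sup>2) - cinner P Q))\<^sup>2 * ((1 - (norm p)\<^sup>2) * (1 - (norm q)\<^sup>2))
      \<le> (r\<^sup>2 - (norm P)\<^sup>2) * (r\<^sup>2 - (norm Q)\<^sup>2) * (cmod (1 - cinner p q))\<^sup>2"
    using n2 ne by (simp add: divide_simps split: if_splits)
qed

text \<open>The Schwarz lemma: when the value at \<open>q\<close> is zero, the determinant
  inequality reduces to \<open>r\<^sup>2 * (1 - phd_sq p q) \<le> r\<^sup>2 - (norm
  P)\<^sup>2\<close>.\<close>

lemma mult_row_two_point_zero:
  assumes F: "\<And>j. F j \<in> mult_alg D V" and r: "r > 0" and le: "row_norm F \<le> ennreal r"
    and pq: "p \<in> V" "q \<in> V" "p \<noteq> q" and zero: "\<And>j. F j q = 0"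
  shows "(norm (\<chi> j. F j p))\<^sup>2 \<le> r\<^sup>2 * phd_sq p q"
proof -
  define P where "P = (\<chi> j. F j p)"
  have Q: "(\<chi> j. F j q) = 0" by (simp add: vec_eq_iff zero)
  have P0: "cinner P 0 = 0" by (simp add: cinner_def)
  define m where "m = (1 - (norm p)\<^sup>2) * (1 - (norm q)\<^sup>2)"
  have ne: "(cmod (1 - cinner p q))\<^sup>2 > 0" using cinner_ne_1[OF subset_ball_norm[OF V] subset_ball_norm[OF V], OF pq(1,2)] by simp
  have "r\<^sup>2 * (r\<^sup>2 * m) \<le> r\<^sup>2 * ((r\<^sup>2 - (norm P)\<^sup>2) * (cmod (1 - cinner p q))\<^sup>2)"
    using mult_row_two_point(2)[OF F r le pq] r
    unfolding Q P_def[symmetric] P0 m_def by (simp add: norm_mult power2_eq_square mult_ac)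
  then have "r\<^sup>2 * m \<le> (r\<^sup>2 - (norm P)\<^sup>2) * (cmod (1 - cinner p q))\<^sup>2"
    by (rule mult_left_le_imp_le) (use r in simp)
  then have "r\<^sup>2 * m / (cmod (1 - cinner p q))\<^sup>2 \<le> r\<^sup>2 - (norm P)\<^sup>2"
    using ne by (simp add: pos_divide_le_eq)
  moreover have "phd_sq p q = 1 - m / (cmod (1 - cinner p q))\<^sup>2" by (simp add: phd_sq_def m_def)
  ultimately show ?thesis unfolding P_def[symmetric] by (simp add: right_diff_distrib)
qed

text \<open>The row divided by \<open>r\<close> is contractive, so Schwarz-Pick applies to the
  values \<open>P\<close> and \<open>Q\<close> divided by \<open>r\<close>; multiplying these by
  \<open>r\<close> again brings in \<open>dilation_contracts\<close>.\<close>

lemma schwarz_pick_strict: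
  assumes F: "\<And>j. F j \<in> mult_alg D V" and le: "row_norm F \<le> ennreal c"
    and c: "0 < c" "c < r" "r < 1"
    and pq: "p \<in> V" "q \<in> V" "p \<noteq> q"
  defines "P \<equiv> (\<chi> j. F j p) :: complex ^ 'd" and "Q \<equiv> (\<chi> j. F j q) :: complex ^ 'd"
  shows "phd_sq P Q * (1 - phd_sq p q) \<le> r\<^sup>2 * (phd_sq p q * (1 - phd_sq P Q))"
proof -
  define A A' a m m' k where "A = (cmod (1 - cinner P Q))\<^sup>2"
    and "A' = (cmod (1 - cinner ((1/r) *\<^sub>R P) ((1/r) *\<^sub>R Q)))\<^sup>2"
    and "a = (cmod (1 - cinner p q))\<^sup>2"
    and "m = (1 - (norm P)\<^sup>2) * (1 - (norm Q)\<^sup>2)"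
    and "m' = (1 - (norm ((1/r) *\<^sub>R P))\<^sup>2) * (1 - (norm ((1/r) *\<^sub>R Q))\<^sup>2)"
    and "k = (1 - (norm p)\<^sup>2) * (1 - (norm q)\<^sup>2)"
  have r: "r > 0" using c by simp
  have le': "row_norm F \<le> ennreal r" using le c by (meson ennreal_leI less_imp_le order_trans)
  \<comment> \<open>The gap between \<open>c\<close> and \<open>r\<close> puts the rescaled values
    in the open ball, so the denominators stay positive.\<close>
  have "norm P \<le> c" "norm Q \<le> c"
    using mult_row_two_point(1)[OF F c(1) le] pq unfolding P_def Q_def by blast+
  then have nPQ: "norm P < r" "norm Q < r" using c by auto
  then have nPQ1: "norm P < 1" "norm Q < 1" using c by auto
  have nPQ': "norm ((1/r) *\<^sub>R P) < 1" "norm ((1/r) *\<^sub>R Q) < 1" using nPQ r by simp_all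
  have pos: "A > 0" "A' > 0" "a > 0"
    using cinner_ne_1[of P Q] cinner_ne_1[OF nPQ'] cinner_ne_1[OF subset_ball_norm[OF V] subset_ball_norm[OF V], OF pq(1,2)] nPQ1
    by (auto simp: A_def A'_def a_def)
  have sq: "x\<^sup>2 < 1" if "0 \<le> x" "x < 1" for x :: real using that by (simp add: abs_square_less_1)
  have m: "m > 0" "m' > 0" "k > 0"
    using sq[OF norm_ge_zero nPQ1(1)] sq[OF norm_ge_zero nPQ1(2)]
      sq[OF norm_ge_zero nPQ'(1)] sq[OF norm_ge_zero nPQ'(2)]
      sq[OF norm_ge_zero subset_ball_norm[OF V pq(1)]] sq[OF norm_ge_zero subset_ball_norm[OF V pq(2)]]
    unfolding m_def m'_def k_def by (auto intro!: mult_pos_pos)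
  have "r *\<^sub>R (1/r) *\<^sub>R P = P" "r *\<^sub>R (1/r) *\<^sub>R Q = Q" using r by simp_all
  then have dil: "(A - m) * m' \<le> r\<^sup>2 * ((A' - m') * m)"
    using dilation_contracts[of r "(1/r) *\<^sub>R P" "(1/r) *\<^sub>R Q"] r c nPQ'
    unfolding A_def A'_def m_def m'_def by simp
  have Am: "m \<le> A"
    using cmod_1_cinner_power2[of P Q] gram_le[of P Q] sq[OF norm_ge_zero nPQ1(2)]
      mult_left_le[of "(norm Q)\<^sup>2" "(norm (P - Q))\<^sup>2"] unfolding A_def m_def by simp
  \<comment> \<open>Schwarz-Pick for the rescaled values, with the common factor
    \<open>r\<^sup>2 * r\<^sup>2\<close> cancelled.\<close>
  have sp: "A' * k \<le> m' * a"
  proof -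
    have s: "(1/r) *\<^sub>R x = of_real (1/r) *s x" for x :: "complex ^ 'd"
      by (simp add: vec_eq_iff scaleR_conv_of_real[where 'a = complex])
    have "of_real (r\<^sup>2) - cinner P Q = of_real (r\<^sup>2) * (1 - cinner ((1/r) *\<^sub>R P) ((1/r) *\<^sub>R Q))"
      unfolding s cinner_scale_left cinner_scale_right using r
      by (simp add: field_simps power2_eq_square)
    then have 1: "(cmod (of_real (r\<^sup>2) - cinner P Q))\<^sup>2 = r\<^sup>2 * r\<^sup>2 * A'"
      by (simp add: A'_def norm_mult power_mult_distrib norm_power)
    have 2: "(r\<^sup>2 - (norm P)\<^sup>2) * (r\<^sup>2 - (norm Q)\<^sup>2) = r\<^sup>2 * r\<^sup>2 * m'"
      using r by (simp add: m'_def power_divide field_simps)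
    have "(r\<^sup>2 * r\<^sup>2) * (A' * k) \<le> (r\<^sup>2 * r\<^sup>2) * (m' * a)"
      using mult_row_two_point(2)[OF F r le' pq] unfolding P_def[symmetric] Q_def[symmetric] 1 2
        k_def[symmetric] a_def[symmetric] by (simp only: mult_ac)
    then show ?thesis by (rule mult_left_le_imp_le) (use r in simp)
  qed
  \<comment> \<open>These are \<open>1 - phd_sq\<close> for the values, the rescaled values and the
    points. The chain below replaces \<open>w\<close> by \<open>v\<close>, applies the dilation
    bound, and returns to \<open>w\<close>.\<close>
  define u v w where "u = m / A" and "v = m' / A'" and "w = k / a"
  have phd: "phd_sq P Q = 1 - u" "phd_sq p q = 1 - w"
    by (simp_all add: phd_sq_def u_def w_def A_def m_def k_def a_def)
  have wv: "w \<le> v" using sp pos by (simp add: v_def w_def divide_simps mult_ac)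
  have u: "0 \<le> u" "u \<le> 1" using Am pos m by (simp_all add: u_def)
  have "(1 - u) * w \<le> (1 - u) * v" using u wv by (intro mult_left_mono) auto
  also have "(1 - u) * v = (A - m) * m' / (A * A')"
    using pos by (simp add: u_def v_def field_simps)
  also have "\<dots> \<le> r\<^sup>2 * ((A' - m') * m) / (A * A')"
    using dil pos by (intro divide_right_mono) auto
  also have "\<dots> = r\<^sup>2 * ((1 - v) * u)"
    using pos by (simp add: u_def v_def field_simps)
  also have "\<dots> \<le> r\<^sup>2 * ((1 - w) * u)"
    using u wv by (intro mult_left_mono mult_right_mono) auto
  finally show ?thesis by (simp add: phd mult_ac)
qed

end

section \<open>Composition isomorphisms\<close>

context
  fixes D :: "(complex ^ 'd) fun_space" and V W :: "(complex ^ 'd) set"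
    and \<phi> :: "(complex ^ 'd \<Rightarrow> complex) \<Rightarrow> complex ^ 'd \<Rightarrow> complex"
    and G :: "complex ^ 'd \<Rightarrow> complex ^ 'd"
  assumes D: "is_drury_arveson D" and V: "V \<subseteq> ball 0 1" and W: "W \<subseteq> ball 0 1"
    and \<phi>: "\<And>f. f \<in> mult_alg D V \<Longrightarrow> \<phi> f \<in> mult_alg D W"
    and comp: "\<And>f. f \<in> mult_alg D V \<Longrightarrow> \<phi> f = restr W (f \<circ> G)"
    and G: "\<And>x. x \<in> W \<Longrightarrow> G x \<in> V"
begin

text \<open>A row becomes a square matrix by adding zero rows.\<close>

lemma row_norm_image_le:
  assumes F: "\<And>j. F j \<in> mult_alg D V" and le: "row_norm D V F \<le> 1"
  shows "row_norm D W (\<lambda>j. \<phi> (F j)) \<le> amp_norm D V W CARD('d) \<phi>"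
proof -
  interpret V: rkhs V da_kernel "HV D V" using D V by (rule HV_rkhs)
  interpret W: rkhs W da_kernel "HV D W" using D W by (rule HV_rkhs)
  obtain b :: "nat \<Rightarrow> 'd" where b: "bij_betw b {..<CARD('d)} UNIV"
    using ex_bij_betw_nat_finite[OF finite[of "UNIV :: 'd set"]] by (auto simp: atLeast0LessThan)
  define A where "A i j = (if i = 0 then F (b j) else 0)" for i j :: nat
  \<comment> \<open>The zero rows of the padded matrix must stay zero under
    \<open>\<phi>\<close>.\<close>
  have \<phi>0: "\<phi> 0 = 0"
    by (simp add: comp[OF zero_in_mult_alg[OF D V]] restr_def fun_eq_iff)
  have A0: "A 0 = (\<lambda>j. F (b j))" by (simp add: A_def fun_eq_iff)
  have "mat_norm D V CARD('d) A = op_norm (HV D V) (UNIV :: unit set) {..<CARD('d)} (\<lambda>_. A 0)"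
    unfolding mat_norm_def by (rule V.op_norm_single_row) (auto simp: A_def)
  also have "\<dots> = row_norm D V F"
    unfolding A0 by (rule op_norm_reindex[OF b, where A = "\<lambda>_. F"])
  finally have 1: "mat_norm D V CARD('d) A = row_norm D V F" .
  have "mat_norm D W CARD('d) (\<lambda>i j. \<phi> (A i j))
      = op_norm (HV D W) (UNIV :: unit set) {..<CARD('d)} (\<lambda>_ j. \<phi> (A 0 j))"
    unfolding mat_norm_def by (rule W.op_norm_single_row) (auto simp: A_def \<phi>0)
  also have "\<dots> = row_norm D W (\<lambda>j. \<phi> (F j))"
    unfolding A0 by (rule op_norm_reindex[OF b, where A = "\<lambda>_ j. \<phi> (F j)"])
  finally have 2: "mat_norm D W CARD('d) (\<lambda>i j. \<phi> (A i j)) = row_norm D W (\<lambda>j. \<phi> (F j))" .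
  have "A \<in> {A. (\<forall>i<CARD('d). \<forall>j<CARD('d). A i j \<in> mult_alg D V) \<and> mat_norm D V CARD('d) A \<le> 1}"
    using F le by (auto simp: 1) (auto simp: A_def zero_in_mult_alg[OF D V])
  then have "mat_norm D W CARD('d) (\<lambda>i j. \<phi> (A i j)) \<le> amp_norm D V W CARD('d) \<phi>"
    unfolding amp_norm_def by (rule SUP_upper)
  then show ?thesis by (simp only: 2)
qed

lemma image_coordinates: "\<phi> (restr V (\<lambda>z. z $ j)) = restr W (\<lambda>x. G x $ j)"
  unfolding comp[OF coordinate_row(1)[OF D V]] using G by (auto simp: restr_def fun_eq_iff)

lemma composition_row:
  "restr W (\<lambda>x. G x $ j) \<in> mult_alg D W"
  using \<phi>[OF coordinate_row(1)[OF D V]] by (simp only: image_coordinates)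

text \<open>The coordinate row is contractive and its image under \<open>\<phi>\<close> is
  \<open>G\<close>.\<close>

lemma mult_norm_le_amp_norm: "mult_norm D W G \<le> amp_norm D V W CARD('d) \<phi>"
  using row_norm_image_le[OF coordinate_row[OF D V]] by (simp only: image_coordinates mult_norm_def)

text \<open>The image of the automorphism row at \<open>G q\<close> has norm at most
  \<open>s\<close> and vanishes at \<open>q\<close>, so the Schwarz lemma bounds its value at
  \<open>p\<close>.\<close>

lemma phd_sq_composition_le:
  assumes s: "s > 0" and amp: "amp_norm D V W CARD('d) \<phi> \<le> ennreal s"
    and pq: "p \<in> W" "q \<in> W" "p \<noteq> q"
  shows "phd_sq (G p) (G q) \<le> s\<^sup>2 * phd_sq p q"
proof -
  have n: "norm (G p) < 1" "norm (G q) < 1" using subset_ball_norm[OF V] G pq by blast+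
  define F where "F j = restr V (\<lambda>z. ball_aut (G q) z $ j)" for j
  have F: "F j \<in> mult_alg D V" "row_norm D V F \<le> 1" for j
    using ball_aut_row[OF D V n(2)] by (simp_all add: F_def[abs_def])
  have \<phi>F: "\<phi> (F j) x = ball_aut (G q) (G x) $ j" if "x \<in> W" for j x
    using that G by (simp add: comp[OF F(1)]) (simp add: F_def)
  have "row_norm D W (\<lambda>j. \<phi> (F j)) \<le> ennreal s"
    using row_norm_image_le[OF F] amp by (rule order_trans)
  then have "(norm (\<chi> j. \<phi> (F j) p))\<^sup>2 \<le> s\<^sup>2 * phd_sq p q"
    using \<phi>[OF F(1)] s pq
    by (intro mult_row_two_point_zero[OF D W]) (auto simp: \<phi>F ball_aut_self[OF n(2)])
  moreover have "(\<chi> j. \<phi> (F j) p) = ball_aut (G q) (G p)"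
    using pq by (simp add: vec_eq_iff \<phi>F)
  ultimately show ?thesis by (simp add: norm_ball_aut n)
qed

text \<open>Strict Schwarz-Pick for the row \<open>G\<close> itself.\<close>

lemma mult_norm_less_1_contracts:
  assumes c: "0 < c" "c < r" "r < 1" and le: "mult_norm D W G \<le> ennreal c"
    and pq: "p \<in> W" "q \<in> W" "p \<noteq> q"
  shows "phd_sq (G p) (G q) * (1 - phd_sq p q) \<le> r\<^sup>2 * (phd_sq p q * (1 - phd_sq (G p) (G q)))"
proof -
  have "(\<chi> j. restr W (\<lambda>x. G x $ j) x) = G x" if "x \<in> W" for x
    using that by (simp add: vec_eq_iff)
  with schwarz_pick_strict[OF D W composition_row le[unfolded mult_norm_def] c pq] pq
  show ?thesis by simp
qed

end

text \<open>The witness makes \<open>s\<^sup>2 * a\<close> the midpoint of \<open>a\<close> and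
  \<open>b\<close>.\<close>

lemma ex_gt_1_square_mult_less:
  fixes a b :: real
  assumes "0 < a" "a < b"
  shows "\<exists>s>1. s\<^sup>2 * a < b"
proof -
  have "sqrt ((a + b) / (2 * a)) > 1" "(sqrt ((a + b) / (2 * a)))\<^sup>2 * a < b"
    using assms by (simp_all add: field_simps)
  then show ?thesis by blast
qed

lemma is_variety_ball: "is_variety D V \<Longrightarrow> V \<subseteq> ball 0 1"
  by (auto simp: is_variety_def)

locale variety_iso =
  fixes D :: "(complex ^ 'd) fun_space" and V W :: "(complex ^ 'd) set"
    and \<phi> :: "(complex ^ 'd \<Rightarrow> complex) \<Rightarrow> complex ^ 'd \<Rightarrow> complex"
  assumes D: "is_drury_arveson D" and V: "V \<subseteq> ball 0 1" and W: "W \<subseteq> ball 0 1"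
    and iso: "mult_alg_iso D V W \<phi>"
begin

abbreviation G where "G \<equiv> coord_map V \<phi>"
abbreviation G' where "G' \<equiv> inv_into W G"
abbreviation \<psi> where "\<psi> \<equiv> inv_into (mult_alg D V) \<phi>"

lemma \<phi>_bij: "bij_betw \<phi> (mult_alg D V) (mult_alg D W)"
  using iso by (simp add: mult_alg_iso_def)

text \<open>The definition of an isomorphism only provides some bijection; applying
  \<open>\<phi>\<close> to the coordinate functions shows that it agrees with
  \<open>coord_map V \<phi>\<close> on \<open>W\<close>.\<close>

lemma G_bij: "bij_betw G W V"
  and \<phi>_comp: "f \<in> mult_alg D V \<Longrightarrow> \<phi> f = restr W (f \<circ> G)"
proof -
  obtain G0 where G0: "bij_betw G0 W V" "\<And>f. f \<in> mult_alg D V \<Longrightarrow> \<phi> f = restr W (f \<circ> G0)"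
    using iso by (auto simp: mult_alg_iso_def)
  have eq: "G x = G0 x" if "x \<in> W" for x
    using that bij_betwE[OF G0(1)] coordinate_row(1)[OF D V]
    by (simp add: coord_map_def vec_eq_iff G0(2))
  show "bij_betw G W V" using G0(1) eq by (simp cong: bij_betw_cong)
  show "\<phi> f = restr W (f \<circ> G)" if "f \<in> mult_alg D V" for f
    using eq by (auto simp: G0(2)[OF that] restr_def fun_eq_iff)
qed

lemma \<phi>_mem: "f \<in> mult_alg D V \<Longrightarrow> \<phi> f \<in> mult_alg D W"
  using bij_betwE[OF \<phi>_bij] by blast

lemma \<psi>_mem: "f \<in> mult_alg D W \<Longrightarrow> \<psi> f \<in> mult_alg D V"
  using bij_betwE[OF bij_betw_inv_into[OF \<phi>_bij]] by blast

lemma G_mem: "x \<in> W \<Longrightarrow> G x \<in> V"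
  using bij_betwE[OF G_bij] by blast

lemma G'_mem: "x \<in> V \<Longrightarrow> G' x \<in> W"
  using bij_betwE[OF bij_betw_inv_into[OF G_bij]] by blast

lemma G_G': "x \<in> V \<Longrightarrow> G (G' x) = x"
  by (rule bij_betw_inv_into_right[OF G_bij])

text \<open>The formula for \<open>\<phi>\<close> applied to \<open>\<psi> f\<close>, evaluated at
  \<open>G' x\<close>.\<close>

lemma \<psi>_comp:
  assumes f: "f \<in> mult_alg D W"
  shows "\<psi> f = restr V (f \<circ> G')"
proof
  fix x
  have "\<phi> (\<psi> f) = f" by (rule bij_betw_inv_into_right[OF \<phi>_bij f])
  then have "f (G' x) = \<psi> f x" if "x \<in> V"
    using \<phi>_comp[OF \<psi>_mem[OF f]] G'_mem[OF that] G_G'[OF that]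
    by (metis comp_apply restr_in)
  moreover have "\<psi> f x = 0" if "x \<notin> V" using \<psi>_mem[OF f] that by (simp add: mult_alg_def)
  ultimately show "\<psi> f x = restr V (f \<circ> G') x" by (simp add: restr_def)
qed

text \<open>The hypotheses of the preceding context, for \<open>\<phi>\<close> with \<open>G\<close>
  and for the inverse with \<open>G'\<close>.\<close>

lemmas forward = D V W \<phi>_mem \<phi>_comp G_mem
lemmas backward = D W V \<psi>_mem \<psi>_comp G'_mem

text \<open>If either norm were at most \<open>c\<close>, that map would strictly contract
  pseudohyperbolic distances, while \<open>amp\<close> bounds their distortion by a factor
  \<open>s\<^sup>2\<close> in both directions. The two smallness conditions make these facts
  contradictory.\<close>

lemma mult_norms_ge:
  assumes xy: "x \<in> V" "y \<in> V" "x \<noteq> y" and c: "0 < c" "c < r" "r < 1" and s: "s > 0"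
    and amp: "amp_norm D V W CARD('d) \<phi> \<le> ennreal s" "amp_norm D W V CARD('d) \<psi> \<le> ennreal s"
  defines "t \<equiv> phd_sq x y"
  shows "s\<^sup>2 * (r\<^sup>2 + (1 - r\<^sup>2) * t) < 1 \<Longrightarrow> ennreal c < mult_norm D W G"
    and "s\<^sup>2 * r\<^sup>2 < 1 - (1 - r\<^sup>2) * t \<Longrightarrow> ennreal c < mult_norm D V G'"
proof -
  have n: "norm x < 1" "norm y < 1" using V xy by auto
  have t: "0 < t" unfolding t_def using phd_sq_pos n xy by blast
  have G'xy: "G' x \<in> W" "G' y \<in> W" "G' x \<noteq> G' y"
    using G'_mem xy G_G' by metis+
  define u where "u = phd_sq (G' x) (G' y)"
  have u: "0 < u"
    unfolding u_def by (rule phd_sq_pos[OF subset_ball_norm[OF W] subset_ball_norm[OF W], OF G'xy])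
  have tu: "t \<le> s\<^sup>2 * u"
    using phd_sq_composition_le[OF forward s amp(1) G'xy] xy by (simp add: G_G' t_def u_def)
  have ut: "u \<le> s\<^sup>2 * t"
    using phd_sq_composition_le[OF backward s amp(2) xy] by (simp add: t_def u_def)
  have r2: "0 \<le> r\<^sup>2" "r\<^sup>2 < 1" using c by (auto simp: abs_square_less_1)
  show "ennreal c < mult_norm D W G" if small: "s\<^sup>2 * (r\<^sup>2 + (1 - r\<^sup>2) * t) < 1"
  proof (rule ccontr)
    assume "\<not> ?thesis"
    then have "t * (1 - u) \<le> r\<^sup>2 * (u * (1 - t))"
      using mult_norm_less_1_contracts[OF forward c _ G'xy] xy by (simp add: G_G' t_def u_def)
    \<comment> \<open>The contraction solved for \<open>t\<close>; next
      \<open>u \<le> s\<^sup>2 * t\<close> gives \<open>t < t\<close>.\<close>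
    then have "t \<le> u * (r\<^sup>2 + (1 - r\<^sup>2) * t)" by (simp add: algebra_simps)
    also have "\<dots> \<le> (s\<^sup>2 * t) * (r\<^sup>2 + (1 - r\<^sup>2) * t)"
      using ut r2 t by (intro mult_right_mono) auto
    also have "\<dots> = t * (s\<^sup>2 * (r\<^sup>2 + (1 - r\<^sup>2) * t))" by (simp add: mult_ac)
    also have "\<dots> < t * 1" using small t by (intro mult_strict_left_mono)
    finally show False by simp
  qed
  show "ennreal c < mult_norm D V G'" if small: "s\<^sup>2 * r\<^sup>2 < 1 - (1 - r\<^sup>2) * t"
  proof (rule ccontr)
    assume "\<not> ?thesis"
    then have "u * (1 - t) \<le> r\<^sup>2 * (t * (1 - u))"
      using mult_norm_less_1_contracts[OF backward c _ xy] by (simp add: t_def u_def)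
    then have "u * (1 - (1 - r\<^sup>2) * t) \<le> t * r\<^sup>2" by (simp add: algebra_simps)
    also have "\<dots> \<le> (s\<^sup>2 * u) * r\<^sup>2" using tu by (intro mult_right_mono) auto
    also have "\<dots> = u * (s\<^sup>2 * r\<^sup>2)" by (simp add: mult_ac)
    also have "\<dots> < u * (1 - (1 - r\<^sup>2) * t)" using small u by (intro mult_strict_left_mono)
    finally show False by simp
  qed
qed

end

theorem theorem1p38:
  fixes D :: "(complex ^ 'd) fun_space"
    and V :: "(complex ^ 'd) set"
    and W :: "nat \<Rightarrow> (complex ^ 'd) set"
    and \<phi> :: "nat \<Rightarrow> (complex ^ 'd \<Rightarrow> complex) \<Rightarrow> complex ^ 'd \<Rightarrow> complex"
  assumes "is_drury_arveson D"
    and "is_variety D V"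
    and "\<exists>x\<in>V. \<exists>y\<in>V. x \<noteq> y"
    and "\<And>n. is_variety D (W n)"
    and "\<And>n. mult_alg_iso D V (W n) (\<phi> n)"
    and "(\<lambda>n. amp_norm D V (W n) CARD('d) (\<phi> n)) \<longlonglongrightarrow> 1"
    and "(\<lambda>n. amp_norm D (W n) V CARD('d) (inv_into (mult_alg D V) (\<phi> n))) \<longlonglongrightarrow> 1"
  shows "(\<lambda>n. mult_norm D (W n) (coord_map V (\<phi> n))) \<longlonglongrightarrow> 1 \<and>
         (\<lambda>n. mult_norm D V (inv_into (W n) (coord_map V (\<phi> n)))) \<longlonglongrightarrow> 1"
proof -
  obtain x y where xy: "x \<in> V" "y \<in> V" "x \<noteq> y" using assms(3) by blast
  have V: "V \<subseteq> ball 0 1" and W: "W n \<subseteq> ball 0 1" for n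
    using assms(2,4) is_variety_ball by blast+
  have iso: "variety_iso D V (W n) (\<phi> n)" for n
    using assms(1,5) V W by unfold_locales
  let ?F = "\<lambda>n. mult_norm D (W n) (coord_map V (\<phi> n))"
  let ?F' = "\<lambda>n. mult_norm D V (inv_into (W n) (coord_map V (\<phi> n)))"
  \<comment> \<open>The pair lies in the fixed variety \<open>V\<close>, so \<open>t\<close> does
    not depend on \<open>n\<close> and the tolerance \<open>s\<close> below can be uniform in
    \<open>n\<close>.\<close>
  define t where "t = phd_sq x y"
  have n: "norm x < 1" "norm y < 1" using V xy by auto
  have t: "0 < t" "t < 1" unfolding t_def using phd_sq_pos phd_sq_less_1 n xy by blast+
  have upper: "?F n \<le> amp_norm D V (W n) CARD('d) (\<phi> n)"
    "?F' n \<le> amp_norm D (W n) V CARD('d) (inv_into (mult_alg D V) (\<phi> n))" for n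
    using mult_norm_le_amp_norm[OF variety_iso.forward[OF iso]]
      mult_norm_le_amp_norm[OF variety_iso.backward[OF iso]] by blast+
  have lower: "\<forall>\<^sub>F n in sequentially. a < ?F n \<and> a < ?F' n" if "a < 1" for a
  proof -
    obtain c0 where c0: "a = ennreal c0" "0 \<le> c0" "c0 < 1"
      using \<open>a < 1\<close> by (cases a) (auto simp: ennreal_less_one_iff)
    \<comment> \<open>Two intermediate values: \<open>c\<close> lies above the target
      \<open>c0\<close>, and \<open>r\<close> leaves the gap between \<open>c\<close> and 1 that
      strict Schwarz-Pick requires.\<close>
    define c r where "c = (c0 + 1) / 2" and "r = (c + 1) / 2"
    have c: "c0 < c" "0 < c" "c < r" "r < 1" using c0 by (auto simp: c_def r_def)
    then have r2: "0 < r\<^sup>2" "r\<^sup>2 < 1" by (auto simp: abs_square_less_1)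
    \<comment> \<open>Here \<open>t < 1\<close> enters: both smallness conditions hold strictly at
      \<open>s = 1\<close>, hence also for some \<open>s > 1\<close>.\<close>
    have tr: "(1 - r\<^sup>2) * t < 1 - r\<^sup>2" using r2 t by simp
    have "0 < (1 - r\<^sup>2) * t" using r2 t by simp
    then obtain s1 where s1: "s1 > 1" "s1\<^sup>2 * (r\<^sup>2 + (1 - r\<^sup>2) * t) < 1"
      using ex_gt_1_square_mult_less[of "r\<^sup>2 + (1 - r\<^sup>2) * t" 1] r2 tr by auto
    obtain s2 where s2: "s2 > 1" "s2\<^sup>2 * r\<^sup>2 < 1 - (1 - r\<^sup>2) * t"
      using ex_gt_1_square_mult_less[of "r\<^sup>2" "1 - (1 - r\<^sup>2) * t"] r2 tr by auto
    define s where "s = min s1 s2"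
    have s: "s > 1" "s\<^sup>2 \<le> s1\<^sup>2" "s\<^sup>2 \<le> s2\<^sup>2"
      using s1(1) s2(1) by (auto simp: s_def intro!: power_mono)
    have small1: "s\<^sup>2 * (r\<^sup>2 + (1 - r\<^sup>2) * t) < 1"
      by (rule le_less_trans[OF mult_right_mono[OF s(2)] s1(2)]) (use r2 t in simp)
    have small2: "s\<^sup>2 * r\<^sup>2 < 1 - (1 - r\<^sup>2) * t"
      by (rule le_less_trans[OF mult_right_mono[OF s(3)] s2(2)]) simp
    have "1 < ennreal s" using s(1) by simp
    then have "\<forall>\<^sub>F n in sequentially. amp_norm D V (W n) CARD('d) (\<phi> n) < ennreal s \<and>
        amp_norm D (W n) V CARD('d) (inv_into (mult_alg D V) (\<phi> n)) < ennreal s"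
      using order_tendstoD(2)[OF assms(6)] order_tendstoD(2)[OF assms(7)]
      by (intro eventually_conj) blast+
    then show ?thesis
    proof (rule eventually_mono)
      fix n
      assume "amp_norm D V (W n) CARD('d) (\<phi> n) < ennreal s \<and>
        amp_norm D (W n) V CARD('d) (inv_into (mult_alg D V) (\<phi> n)) < ennreal s"
      then have "ennreal c < ?F n" "ennreal c < ?F' n"
        using variety_iso.mult_norms_ge[OF iso xy c(2-4), of s] s(1) small1 small2
        by (simp_all add: t_def less_imp_le)
      moreover have "a \<le> ennreal c" unfolding c0(1) using c by (intro ennreal_leI) simp
      ultimately show "a < ?F n \<and> a < ?F' n" by (meson le_less_trans)
    qed
  qed
  show ?thesis
  proof (intro conjI order_tendstoI)
    show "\<forall>\<^sub>F n in sequentially. a < ?F n" "\<forall>\<^sub>F n in sequentially. a < ?F' n" if "a < 1" for a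
      using lower[OF that] by (auto elim: eventually_mono)
    show "\<forall>\<^sub>F n in sequentially. ?F n < a" if "1 < a" for a
      using order_tendstoD(2)[OF assms(6) that] upper(1)
      by (auto elim!: eventually_mono intro: le_less_trans)
    show "\<forall>\<^sub>F n in sequentially. ?F' n < a" if "1 < a" for a
      using order_tendstoD(2)[OF assms(7) that] upper(2)
      by (auto elim!: eventually_mono intro: le_less_trans)
  qed
qed

end
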